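(* Let $\Gamma$ be a discrete subgroup of $SL(2,\mathbb{R})$ containing translations. Let $\mu,\nu$ be nonnegative integers, let $\phi$ and $\psi$ be modular forms for $\Gamma$ of weights $\mu$ and $\nu$ respectively, with width $h$ (that is, with Fourier expansions of the form $\sum_{k\ge 0} c_k e^{2\pi i k z/h}$), and let $m,n\ge 0$ be integers. Then the Dirichlet series of the quasimodular form $\phi^{(m)}\psi^{(n)}$ can be written in the form $$L(\phi^{(m)}\psi^{(n)}, s)=\sum_{\ell=0}^{m+n} a^{m,n}_{\mu,\nu}(\ell)\, L\bigl([\phi,\psi]^{(\mu,\nu)}_{m+n-\ell},\, s-\ell\bigr),$$ where, for $0\le \ell\le m+n$, $$a^{m,n}_{\mu,\nu}(\ell)=\frac{(2\pi i)^\ell\, n!\,(\mu+m-1)!\,(\nu+n-1)!\,(\mu+\nu+2\ell-1)}{(\mu+\ell-1)!\,(\mu+\nu+2m+2n-\ell-1)!\,h^\ell}\sum_{j=0}^{\ell}(-1)^j\,\frac{(m+n-\ell+j)!\,(2\ell+\mu+\nu-j-2)!}{j!\,(\ell-j)!\,(n-\ell+j)!\,(\nu+\ell-j-1)!},$$ with terms of the sum for which $n-\ell+j<0$ read as $0$.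
   Context: Let $\mathcal{H}$ be the upper half plane. $\mathcal{F}$ denotes the ring of holomorphic functions $f:\mathcal{H}\to\mathbb{C}$ for which there is some $\kappa>0$ with $|f(z)|\ll \bigl(\mathrm{Im}\,z/(1+|z|^2)\bigr)^{-\kappa}$ on $\mathcal{H}$. A modular form for $\Gamma$ of weight $\lambda\in\mathbb{Z}$ is an $f\in\mathcal{F}$ with $(cz+d)^{-\lambda}f\bigl(\frac{az+b}{cz+d}\bigr)=f(z)$ for all $\begin{pmatrix}a&b\\c&d\end{pmatrix}\in\Gamma$ and $z\in\mathcal{H}$. The space of these is $M_\lambda(\Gamma)$. A quasimodular form for $\Gamma$ of weight $\lambda$ and depth at most $p$ is an $f\in\mathcal{F}$ for which there are $f_0,\ldots,f_p\in\mathcal{F}$ with $(cz+d)^{-\lambda}f\bigl(\frac{az+b}{cz+d}\bigr)=\sum_{r=0}^{p} f_r(z)\bigl(\frac{c}{cz+d}\bigr)^r$ for all $\begin{pmatrix}a&b\\c&d\end{pmatrix}\in\Gamma$ and $z\in\mathcal{H}$. The product $\phi^{(m)}\psi^{(n)}$ is a quasimodular form of weight $\mu+\nu+2m+2n$ and depth at most $m+n$. $f^{(r)}$ denotes the $r$-th derivative $d^r f/dz^r$. For $f\in M_k(\Gamma)$, $g\in M_l(\Gamma)$ and an integer $w\ge 0$, the Rankin-Cohen bracket is $$[f,g]^{(k,l)}_w=\sum_{r=0}^{w}(-1)^r\binom{k+w-1}{w-r}\binom{l+w-1}{r} f^{(r)}g^{(w-r)}\in M_{k+l+2w}(\Gamma).$$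 If $F\in\mathcal{F}$ has a Fourier expansion $F(z)=\sum_{k=0}^\infty a_k e^{2\pi i k z/h}$, with $h$ a fixed real number, its Dirichlet series is $L(F,s)=\sum_{k=1}^\infty a_k k^{-s}$, which converges for $\mathrm{Re}\, s\gg 0$. All Dirichlet series in the statement are formed with respect to the same $h$.
   Formalization: The printed coefficient is false (e.g. m=1, n=0, μ=ν=1). Proved with w=m+n−ℓ in place of ℓ, except in (2πi)^ℓ, h^ℓ and (μ+ν+2m+2n−ℓ−1)!, and an extra factor w!/ℓ!; assumes μ+m≥1, ν+n≥1, μ+ν≥2 so the factorials are defined; 1/k!=0 for k<0. *)

theory Defs
  imports "HOL-Analysis.Analysis" "HOL-Algebra.Group"
begin

definition upper_half_plane :: "complex set" where
  "upper_half_plane = {z. Im z > 0}"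

text \<open>The ring \<open>\<F>\<close>. Functions on the upper half plane are total functions on the complex
  plane whose values elsewhere are irrelevant.\<close>

definition moderate_holomorphic :: "(complex \<Rightarrow> complex) set" where
  "moderate_holomorphic = {f. f holomorphic_on upper_half_plane \<and>
     (\<exists>\<kappa>>0. \<exists>C. \<forall>z\<in>upper_half_plane.
        norm (f z) \<le> C * (Im z / (1 + (norm z)\<^sup>2)) powr (-\<kappa>))}"

definition SL2R :: "(real^2^2) monoid" where
  "SL2R = \<lparr>carrier = {A. det A = 1}, mult = (**), one = mat 1\<rparr>"

text \<open>For a subgroup, containing a nontrivial translation of the upper half plane is the same as
  containing some matrix \<open>(1 t; 0 1)\<close> with \<open>t \<noteq> 0\<close>: if only \<open>-(1 t; 0 1)\<close> is given, square it.\<close>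

definition contains_translations :: "(real^2^2) set \<Rightarrow> bool" where
  "contains_translations \<Gamma> \<longleftrightarrow> (\<exists>t. t \<noteq> 0 \<and> vector [vector [1, t], vector [0, 1]] \<in> \<Gamma>)"

definition automorphy_factor :: "real^2^2 \<Rightarrow> complex \<Rightarrow> complex" where
  "automorphy_factor A z = complex_of_real (A$2$1) * z + complex_of_real (A$2$2)"

definition moebius_act :: "real^2^2 \<Rightarrow> complex \<Rightarrow> complex" where
  "moebius_act A z =
     (complex_of_real (A$1$1) * z + complex_of_real (A$1$2)) / automorphy_factor A z"

definition modular_forms :: "(real^2^2) set \<Rightarrow> int \<Rightarrow> (complex \<Rightarrow> complex) set" where
  "modular_forms \<Gamma> k = {f \<in> moderate_holomorphic. \<forall>A\<in>\<Gamma>. \<forall>z\<in>upper_half_plane.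
     automorphy_factor A z powi (-k) * f (moebius_act A z) = f z}"

text \<open>The natural number subtraction \<open>k + w - 1\<close> truncates only for \<open>k = w = 0\<close>, where the only
  binomial coefficient that occurs has lower entry \<open>0\<close> and is \<open>1\<close> for either upper entry.\<close>

definition rankin_cohen ::
  "nat \<Rightarrow> nat \<Rightarrow> nat \<Rightarrow> (complex \<Rightarrow> complex) \<Rightarrow> (complex \<Rightarrow> complex) \<Rightarrow> complex \<Rightarrow> complex" where
  "rankin_cohen k l w f g z =
     (\<Sum>r=0..w. (-1) ^ r * of_nat ((k + w - 1) choose (w - r)) * of_nat ((l + w - 1) choose r)
        * (deriv ^^ r) f z * (deriv ^^ (w - r)) g z)"

definition has_fourier_expansion :: "real \<Rightarrow> (complex \<Rightarrow> complex) \<Rightarrow> (nat \<Rightarrow> complex) \<Rightarrow> bool" where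
  "has_fourier_expansion h F a \<longleftrightarrow> (\<forall>z\<in>upper_half_plane.
     (\<lambda>k. a k * exp (2 * of_real pi * \<i> * of_nat k * z / of_real h)) sums F z)"

text \<open>For \<open>h \<noteq> 0\<close> the coefficients are uniquely determined by \<open>F\<close>.\<close>

definition fourier_coeff :: "real \<Rightarrow> (complex \<Rightarrow> complex) \<Rightarrow> nat \<Rightarrow> complex" where
  "fourier_coeff h F = (SOME a. has_fourier_expansion h F a)"

definition dirichlet_L :: "real \<Rightarrow> (complex \<Rightarrow> complex) \<Rightarrow> complex \<Rightarrow> complex" where
  "dirichlet_L h F s = (\<Sum>k. fourier_coeff h F (Suc k) * of_nat (Suc k) powr (-s))"

text \<open>The condition under which the value of \<open>dirichlet_L\<close> is meaningful.\<close>

definition dirichlet_L_converges :: "real \<Rightarrow> (complex \<Rightarrow> complex) \<Rightarrow> complex \<Rightarrow> bool" where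
  "dirichlet_L_converges h F s \<longleftrightarrow> (\<exists>a. has_fourier_expansion h F a) \<and>
     summable (\<lambda>k. fourier_coeff h F (Suc k) * of_nat (Suc k) powr (-s))"

text \<open>\<open>1 / k!\<close>, which is \<open>0\<close> for negative \<open>k\<close>.\<close>

definition recip_fact :: "int \<Rightarrow> complex" where
  "recip_fact k = (if k < 0 then 0 else 1 / fact (nat k))"

text \<open>The coefficient of \<open>L([\<phi>,\<psi>]\<^sub>w, s - l)\<close>, where \<open>w = m + n - l\<close>. The published formula has
  \<open>l\<close> in place of \<open>w\<close> throughout and lacks the factor \<open>w! / l!\<close>. That version is wrong already for
  \<open>m = 1\<close>, \<open>n = 0\<close>, where the identity \<open>(\<mu> + \<nu>) \<phi>' \<psi> = \<mu> (\<phi> \<psi>)' - [\<phi>,\<psi>]\<^sub>1\<close> forces the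
  values \<open>-1 / (\<mu> + \<nu>)\<close> for \<open>l = 0\<close> and \<open>(2 \<pi> i / h) \<mu> / (\<mu> + \<nu>)\<close> for \<open>l = 1\<close>.

  The natural number subtractions do not truncate if \<open>l \<le> m + n\<close>, \<open>1 \<le> \<mu> + m\<close>,
  \<open>1 \<le> \<nu> + n\<close> and \<open>2 \<le> \<mu> + \<nu>\<close>.\<close>

definition rc_coeff :: "nat \<Rightarrow> nat \<Rightarrow> nat \<Rightarrow> nat \<Rightarrow> real \<Rightarrow> nat \<Rightarrow> complex" where
  "rc_coeff \<mu> \<nu> m n h l = (let w = m + n - l in
     (2 * of_real pi * \<i>) ^ l * fact n * fact (\<mu> + m - 1) * fact (\<nu> + n - 1)
       * of_nat (\<mu> + \<nu> + 2 * w - 1) * fact w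
       * recip_fact (int \<mu> + int w - 1)
       / (fact l * fact (\<mu> + \<nu> + 2 * m + 2 * n - l - 1) * of_real h ^ l)
     * (\<Sum>j=0..w. (-1) ^ j * fact (m + n - w + j) * fact (2 * w + \<mu> + \<nu> - j - 2)
          / (fact j * fact (w - j))
          * recip_fact (int n - int w + int j)
          * recip_fact (int \<nu> + int w - int j - 1)))"

end

theory Submission
  imports Defs "HOL-Computational_Algebra.Polynomial"
    "HOL-Complex_Analysis.Cauchy_Integral_Formula"
begin

text \<open>
  Let \<open>D = d/dz\<close>, and write \<open>\<phi>\<^bsup>(r)\<^esup>\<psi>\<^bsup>(s)\<^esup>\<close> as the monomial \<open>x\<^sup>r y\<^sup>s\<close>. By the product rule \<open>D\<close> becomes
  multiplication by \<open>x + y\<close>, and the bracket \<open>[\<phi>, \<psi>]\<^sub>w\<close> becomes a form \<open>R\<^sub>w(x, y)\<close> of degree \<open>w\<close>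
  (\<open>bracket_form\<close>), a homogenized Jacobi polynomial. The theorem amounts to the polynomial identity
  \<open>x\<^sup>m y\<^sup>n = \<Sum>\<^sub>l A\<^sub>l (x + y)\<^sup>l R\<^sub>w(x, y)\<close> with \<open>w = m + n - l\<close> (\<open>monomial_eq_sum_bracket_form\<close>). In terms of
  Fourier coefficients, \<open>x\<close> and \<open>y\<close> stand for \<open>2\<pi>i/h\<close> times the indices of the coefficients of \<open>\<phi>\<close>
  and \<open>\<psi>\<close>, so that \<open>(x + y)\<^sup>l\<close> multiplies the \<open>k\<close>-th coefficient of a product by \<open>(2\<pi>ik/h)\<^sup>l\<close>; in a
  Dirichlet series this factor shifts \<open>s\<close> to \<open>s - l\<close>.

  The identity comes from the representation theory of \<open>sl\<^sub>2\<close>. The raising operator is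
  multiplication by \<open>x + y\<close>; the lowering operator is
  \<open>x \<partial>\<^sub>x\<^sup>2 + \<mu> \<partial>\<^sub>x + y \<partial>\<^sub>y\<^sup>2 + \<nu> \<partial>\<^sub>y\<close>. The \<open>R\<^sub>w\<close> are killed by the lowering operator
  (\<open>lowering_bracket_poly\<close>), so that its effect on \<open>(x + y)\<^sup>l R\<^sub>w\<close> is a scalar multiple of
  \<open>(x + y)\<^bsup>l-1\<^esup> R\<^sub>w\<close> (\<open>lowering_power\<close>). Applied to the identity for \<open>(m, n)\<close>, it yields a combination of the
  identities for \<open>(m - 1, n)\<close> and \<open>(m, n - 1)\<close>, because the coefficients \<open>A\<^sub>l\<close> satisfy the
  corresponding recurrence (\<open>bracket_coeff_recurrence\<close>). By induction the difference of the two sides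
  is killed by the lowering operator. It also vanishes on \<open>x + y = 0\<close>, where only \<open>A\<^sub>0\<close>
  enters (\<open>bracket_coeff_top\<close>), and a form with both properties is \<open>0\<close>
  (\<open>lowering_eq_0_imp_eq_0\<close>).

  The analytic part is independent of the sign of \<open>h\<close>. An expansion in powers of
  \<open>q = e\<^bsup>2\<pi>iz/h\<^esup>\<close> that converges on the whole half plane can be differentiated and multiplied
  as a power series in \<open>q\<close>. Cauchy's inequality on the circle onto which \<open>Im z = y\<close> is mapped
  (\<open>fourier_coeff_bound\<close>) shows both that the coefficients are unique and, for \<open>y = 1/(k + 1)\<close>,
  that those of a function of moderate growth grow polynomially. Hence all Dirichlet series that occur
  converge absolutely in a right half plane.
\<close>

section \<open>Alternating binomial sums and reciprocal factorials\<close>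

text \<open>By Pascal's rule, an \<open>(n + 1)\<close>-st finite difference is the \<open>n\<close>-th finite difference of a first difference.\<close>

lemma alternating_binomial_sum_Suc:
  fixes f :: "nat \<Rightarrow> 'a::comm_ring_1"
  shows "(\<Sum>i\<le>Suc n. (-1) ^ i * of_nat (Suc n choose i) * f i)
       = (\<Sum>i\<le>n. (-1) ^ i * of_nat (n choose i) * (f i - f (Suc i)))"
proof -
  have "(\<Sum>i\<le>Suc n. (-1) ^ i * of_nat (Suc n choose i) * f i)
      = f 0 + (\<Sum>i\<le>n. (-1) ^ Suc i * of_nat (Suc n choose Suc i) * f (Suc i))"
    by (subst sum.atMost_Suc_shift) simp
  also have "\<dots> = (f 0 + (\<Sum>i\<le>n. (-1) ^ Suc i * of_nat (n choose Suc i) * f (Suc i)))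
      - (\<Sum>i\<le>n. (-1) ^ i * of_nat (n choose i) * f (Suc i))"
    by (simp add: algebra_simps sum.distrib sum_negf sum_subtractf)
  also have "f 0 + (\<Sum>i\<le>n. (-1) ^ Suc i * of_nat (n choose Suc i) * f (Suc i))
      = (\<Sum>i\<le>Suc n. (-1) ^ i * of_nat (n choose i) * f i)"
    by (subst sum.atMost_Suc_shift) simp
  also have "\<dots> = (\<Sum>i\<le>n. (-1) ^ i * of_nat (n choose i) * f i)"
    by (simp add: binomial_eq_0)
  finally show ?thesis
    by (simp add: algebra_simps sum_subtractf)
qed

text \<open>A first difference of \<open>M \<mapsto> (M choose k)\<close> lowers both entries by one, so that the \<open>n\<close>-th
  difference lowers them by \<open>n\<close>, and is \<open>0\<close> once \<open>n\<close> exceeds the degree \<open>k\<close>.\<close>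

lemma alternating_binomial_sum_binomial:
  assumes "n \<le> M"
  shows "(\<Sum>i\<le>n. (-1) ^ i * of_nat (n choose i) * of_nat ((M - i) choose k))
       = (if n \<le> k then of_nat ((M - n) choose (k - n)) else (0::'a::comm_ring_1))"
  using assms
proof (induction n arbitrary: M k)
  case 0
  then show ?case by simp
next
  case (Suc n)
  have diff: "of_nat ((M - i) choose k) - of_nat ((M - Suc i) choose k)
      = (if k = 0 then 0 else of_nat (((M - 1) - i) choose (k - 1)) :: 'a)" if "i \<le> n" for i
  proof -
    define a where "a = M - Suc i"
    have a: "M - i = Suc a" "M - Suc i = a" "M - 1 - i = a"
      using that Suc.prems by (auto simp: a_def)
    show ?thesis unfolding a by (cases k) auto
  qed
  have "(\<Sum>i\<le>Suc n. (-1) ^ i * of_nat (Suc n choose i) * of_nat ((M - i) choose k))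
      = (\<Sum>i\<le>n. (-1) ^ i * of_nat (n choose i) *
           (if k = 0 then 0 else of_nat (((M - 1) - i) choose (k - 1)) :: 'a))"
    unfolding alternating_binomial_sum_Suc by (intro sum.cong refl) (simp add: diff)
  also have "\<dots> = (if Suc n \<le> k then of_nat ((M - Suc n) choose (k - Suc n)) else 0)"
    using Suc.IH[of "M - 1" "k - 1"] Suc.prems by (cases k) auto
  finally show ?case .
qed

lemma recip_fact_nonneg: "recip_fact (int k) = 1 / fact k"
  by (simp add: recip_fact_def)

lemma recip_fact_minus_one: "recip_fact (k - 1) = of_int k * recip_fact k"
proof (cases "k \<le> 0")
  case False
  then obtain a where k: "k = int (Suc a)"
    by (metis not_le zero_less_imp_eq_int Suc_pred)
  then have "recip_fact (k - 1) = 1 / fact a"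
    by (simp add: recip_fact_nonneg)
  then show ?thesis
    unfolding k recip_fact_nonneg fact_Suc of_int_of_nat_eq
    by (simp del: of_nat_Suc)
qed (auto simp: recip_fact_def)

text \<open>Both sides are \<open>0\<close> for \<open>a < k\<close>; thus reciprocal factorials of possibly negative integers
  turn into binomial coefficients without a case distinction.\<close>

lemma fact_mult_recip_fact_diff:
  "fact a * recip_fact (int a - int k) = fact k * of_nat (a choose k)"
proof (cases "k \<le> a")
  case True
  then have "int a - int k = int (a - k)" by simp
  then show ?thesis
    using True by (simp only: recip_fact_nonneg) (simp add: binomial_fact field_simps)
qed (simp add: recip_fact_def binomial_eq_0)

section \<open>The lowering operator\<close>

text \<open>The operator \<open>x \<partial>\<^sub>x\<^sup>2 + \<mu> \<partial>\<^sub>x + y \<partial>\<^sub>y\<^sup>2 + \<nu> \<partial>\<^sub>y\<close> on binary forms of degree \<open>N\<close>, which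
  corresponds to \<open>\<phi>\<^bsup>(r)\<^esup> \<mapsto> r(\<mu> + r - 1) \<phi>\<^bsup>(r-1)\<^esup>\<close> and its analogue for \<open>\<psi>\<close>, extended as a derivation. A form is represented by
  its restriction to \<open>y = 1\<close>, a polynomial of degree at most \<open>N\<close>. There \<open>y \<partial>\<^sub>y\<close> acts as
  \<open>N - x \<partial>\<^sub>x\<close>, and the operator becomes the hypergeometric differential operator of the Jacobi
  polynomials. The degree \<open>N\<close> has to be given because the polynomial does not determine it.\<close>

definition lowering :: "nat \<Rightarrow> nat \<Rightarrow> nat \<Rightarrow> complex poly \<Rightarrow> complex poly" where
  "lowering \<mu> \<nu> N p = [:0, 1, 1:] * pderiv (pderiv p)
     + [:of_nat \<mu>, 2 - of_nat \<nu> - 2 * of_nat N:] * pderiv p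
     + smult (of_nat N * (of_nat N + of_nat \<nu> - 1)) p"

lemma coeff_lowering:
  "coeff (lowering \<mu> \<nu> N p) r =
     (of_nat r + 1) * (of_nat \<mu> + of_nat r) * coeff p (Suc r)
     + (of_nat N - of_nat r) * (of_nat \<nu> + of_nat N - of_nat r - 1) * coeff p r"
proof (cases r)
  case 0
  then show ?thesis
    by (simp add: lowering_def coeff_pderiv algebra_simps)
next
  case (Suc r')
  show ?thesis
  proof (cases r')
    case 0
    then show ?thesis using Suc
      by (simp add: lowering_def coeff_pderiv algebra_simps eval_nat_numeral)
  next
    case (Suc r'')
    then show ?thesis using \<open>r = Suc r'\<close>
      by (simp add: lowering_def coeff_pderiv algebra_simps eval_nat_numeral)
  qed
qed

lemma lowering_0: "lowering \<mu> \<nu> N 0 = 0"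
  by (simp add: lowering_def)

lemma lowering_add: "lowering \<mu> \<nu> N (p + q) = lowering \<mu> \<nu> N p + lowering \<mu> \<nu> N q"
  by (rule poly_eqI) (simp add: coeff_lowering algebra_simps)

lemma lowering_diff: "lowering \<mu> \<nu> N (p - q) = lowering \<mu> \<nu> N p - lowering \<mu> \<nu> N q"
  by (rule poly_eqI) (simp add: coeff_lowering algebra_simps)

lemma lowering_smult: "lowering \<mu> \<nu> N (smult c p) = smult c (lowering \<mu> \<nu> N p)"
  by (rule poly_eqI) (simp add: coeff_lowering algebra_simps)

lemma lowering_sum: "lowering \<mu> \<nu> N (\<Sum>i\<in>I. p i) = (\<Sum>i\<in>I. lowering \<mu> \<nu> N (p i))"
  by (induction I rule: infinite_finite_induct) (auto simp: lowering_0 lowering_add)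

lemma smult_sum_right: "smult c (\<Sum>i\<in>I. p i) = (\<Sum>i\<in>I. smult c (p i))"
  by (rule poly_eqI) (simp add: coeff_sum sum_distrib_left)

text \<open>The commutation relation of \<open>sl\<^sub>2\<close>: the commutator of lowering and raising acts on forms of
  degree \<open>N\<close> as the scalar \<open>\<mu> + \<nu> + 2N\<close>, their weight.\<close>

lemma lowering_Suc:
  "lowering \<mu> \<nu> (Suc N) ([:1, 1:] * p)
     = [:1, 1:] * lowering \<mu> \<nu> N p + smult (of_nat (\<mu> + \<nu> + 2 * N)) p"
proof (rule poly_eqI)
  fix r
  show "coeff (lowering \<mu> \<nu> (Suc N) ([:1, 1:] * p)) r
      = coeff ([:1, 1:] * lowering \<mu> \<nu> N p + smult (of_nat (\<mu> + \<nu> + 2 * N)) p) r"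
    by (cases r) (simp_all add: coeff_lowering algebra_simps)
qed

text \<open>The scalar is the sum of the weights \<open>\<mu> + \<nu> + 2(N + i)\<close> for \<open>i = 0, \<dots>, k\<close>.\<close>

lemma lowering_power:
  "lowering \<mu> \<nu> (N + Suc k) ([:1, 1:] ^ Suc k * p)
     = [:1, 1:] ^ Suc k * lowering \<mu> \<nu> N p
       + smult (of_nat (Suc k * (\<mu> + \<nu> + 2 * N + k))) ([:1, 1:] ^ k * p)"
proof (induction k)
  case 0
  then show ?case
    using lowering_Suc[of \<mu> \<nu> N p] by (simp del: mult_pCons_left)
next
  case (Suc k)
  have "lowering \<mu> \<nu> (N + Suc (Suc k)) ([:1, 1:] ^ Suc (Suc k) * p)
      = lowering \<mu> \<nu> (Suc (N + Suc k)) ([:1, 1:] * ([:1, 1:] ^ Suc k * p))"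
    by (simp only: mult.assoc power_Suc add_Suc_right)
  also have "\<dots> = [:1, 1:] * lowering \<mu> \<nu> (N + Suc k) ([:1, 1:] ^ Suc k * p)
      + smult (of_nat (\<mu> + \<nu> + 2 * (N + Suc k))) ([:1, 1:] ^ Suc k * p)"
    by (rule lowering_Suc)
  also have "[:1, 1:] * lowering \<mu> \<nu> (N + Suc k) ([:1, 1:] ^ Suc k * p)
      = [:1, 1:] ^ Suc (Suc k) * lowering \<mu> \<nu> N p
       + smult (of_nat (Suc k * (\<mu> + \<nu> + 2 * N + k))) ([:1, 1:] ^ Suc k * p)"
    unfolding Suc.IH distrib_left mult_smult_right by (simp only: mult.assoc power_Suc)
  also have "\<dots> + smult (of_nat (\<mu> + \<nu> + 2 * (N + Suc k))) ([:1, 1:] ^ Suc k * p)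
      = [:1, 1:] ^ Suc (Suc k) * lowering \<mu> \<nu> N p
       + smult (of_nat (Suc (Suc k) * (\<mu> + \<nu> + 2 * N + Suc k))) ([:1, 1:] ^ Suc k * p)"
    unfolding add.assoc smult_add_left[symmetric] of_nat_add[symmetric]
    by (intro arg_cong2[of _ _ _ _ "(+)"] arg_cong2[of _ _ _ _ smult] arg_cong[of _ _ of_nat] refl)
      (simp add: algebra_simps)
  finally show ?case .
qed

text \<open>If \<open>p = (1 + x)\<^sup>k q\<close> with \<open>k \<ge> 1\<close> the exact order of vanishing at \<open>-1\<close>, then the lowering
  operator maps \<open>p\<close> to a polynomial that vanishes at \<open>-1\<close> only to the order \<open>k - 1\<close>: its leading
  coefficient at \<open>-1\<close> is \<open>q(-1)\<close> times a scalar that is positive because \<open>k \<le> N\<close>. This argument holds for \<open>\<mu> = 0\<close> and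
  \<open>\<nu> = 0\<close> too, where the monomials killed by the operator differ from those in the generic case.\<close>

lemma lowering_eq_0_imp_eq_0:
  assumes "lowering \<mu> \<nu> N p = 0" "poly p (-1) = 0" "degree p \<le> N" "2 \<le> \<mu> + \<nu>"
  shows "p = 0"
proof (rule ccontr)
  assume "p \<noteq> 0"
  define k where "k = Polynomial.order (-1) p"
  obtain q where q: "p = [:1, 1:] ^ k * q" "poly q (-1) \<noteq> 0"
    using order_decomp[OF \<open>p \<noteq> 0\<close>, of "-1"] by (auto simp: k_def poly_eq_0_iff_dvd)
  have "k \<noteq> 0"
    using assms(2) q by (intro notI) auto
  moreover have "k \<le> N"
    using order_degree[OF \<open>p \<noteq> 0\<close>, of "-1"] assms(3) by (simp add: k_def)
  ultimately obtain k' N' where k: "k = Suc k'" and N: "N = N' + Suc k'"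
    by (metis add.commute le_Suc_ex not0_implies_Suc)
  have "[:1, 1:] ^ k' * ([:1, 1:] * lowering \<mu> \<nu> N' q
        + smult (of_nat (Suc k' * (\<mu> + \<nu> + 2 * N' + k'))) q) = 0"
    using assms(1) lowering_power[of \<mu> \<nu> N' k' q] unfolding q(1) k N
    by (simp add: algebra_simps)
  then have "[:1, 1:] * lowering \<mu> \<nu> N' q
        + smult (of_nat (Suc k' * (\<mu> + \<nu> + 2 * N' + k'))) q = 0"
    by (metis mult_eq_0_iff pCons_eq_0_iff power_eq_0_iff zero_neq_one)
  then have "poly ([:1, 1:] * lowering \<mu> \<nu> N' q
        + smult (of_nat (Suc k' * (\<mu> + \<nu> + 2 * N' + k'))) q) (-1) = 0"
    by simp
  then have "of_nat (Suc k' * (\<mu> + \<nu> + 2 * N' + k')) * poly q (-1) = 0"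
    by (simp del: of_nat_mult of_nat_Suc)
  then show False
    using q(2) assms(4) by (simp del: of_nat_mult of_nat_Suc of_nat_add)
qed

text \<open>For \<open>m = 0\<close> or \<open>n = 0\<close> the truncated subtractions are harmless, since the factor \<open>m\<close> or \<open>n\<close>
  in front vanishes.\<close>

lemma lowering_monom:
  "lowering \<mu> \<nu> (m + n) (monom 1 m)
     = smult (of_nat (m * (\<mu> + m - 1))) (monom 1 (m - 1))
       + smult (of_nat (n * (\<nu> + n - 1))) (monom 1 m)"
proof -
  have nat: "of_nat (a * (b + a - 1)) = of_nat a * (of_nat b + of_nat a - (1::complex))" for a b
    by (cases a) (auto simp: algebra_simps)
  show ?thesis
  proof (rule poly_eqI)
    fix r
    show "coeff (lowering \<mu> \<nu> (m + n) (monom 1 m)) r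
      = coeff (smult (of_nat (m * (\<mu> + m - 1))) (monom 1 (m - 1))
         + smult (of_nat (n * (\<nu> + n - 1))) (monom 1 m)) r"
      unfolding coeff_lowering coeff_add coeff_smult nat coeff_monom
      by (cases m) auto
  qed
qed

section \<open>Rankin--Cohen polynomials\<close>

text \<open>The polynomial \<open>R\<^sub>w(x, 1)\<close> of the bracket \<open>[\<phi>, \<psi>]\<^sub>w\<close>, up to normalization a Jacobi polynomial.\<close>

definition bracket_poly :: "nat \<Rightarrow> nat \<Rightarrow> nat \<Rightarrow> complex poly" where
  "bracket_poly \<mu> \<nu> w = (\<Sum>r\<le>w. monom ((-1) ^ r
     * of_nat ((\<mu> + w - 1) choose (w - r)) * of_nat ((\<nu> + w - 1) choose r)) r)"

lemma coeff_bracket_poly: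
  "coeff (bracket_poly \<mu> \<nu> w) r = (if r \<le> w then (-1) ^ r
     * of_nat ((\<mu> + w - 1) choose (w - r)) * of_nat ((\<nu> + w - 1) choose r) else 0)"
  unfolding bracket_poly_def coeff_sum coeff_monom by simp

lemma degree_bracket_poly: "degree (bracket_poly \<mu> \<nu> w) \<le> w"
  by (rule degree_le) (simp add: coeff_bracket_poly)

lemma Suc_times_binomial_Suc: "Suc r * (a choose Suc r) = (a - r) * (a choose r)"
  by (metis Suc_times_binomial_add binomial_absorb_comp binomial_absorption diff_Suc_1 mult.commute)

text \<open>Algebraic form of the modularity of Rankin--Cohen brackets: they are the lowest weight vectors.\<close>

lemma lowering_bracket_poly: "lowering \<mu> \<nu> w (bracket_poly \<mu> \<nu> w) = 0"
proof (rule poly_eqI)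
  fix r
  show "coeff (lowering \<mu> \<nu> w (bracket_poly \<mu> \<nu> w)) r = coeff 0 r"
  proof (cases "r < w")
    case True
    define u where "u = w - Suc r"
    have u: "w - r = Suc u" "w - Suc r = u" "w = Suc (r + u)"
      using True by (auto simp: u_def)
    have 1: "(of_nat u + 1) * of_nat ((\<mu> + w - 1) choose Suc u)
        = (of_nat \<mu> + of_nat r) * (of_nat ((\<mu> + w - 1) choose u) :: complex)"
      using arg_cong[OF Suc_times_binomial_Suc[of u "\<mu> + w - 1"], of "of_nat :: nat \<Rightarrow> complex"]
      by (simp add: u algebra_simps)
    have 2: "(of_nat r + 1) * of_nat ((\<nu> + w - 1) choose Suc r)
        = (of_nat \<nu> + of_nat u) * (of_nat ((\<nu> + w - 1) choose r) :: complex)"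
      using arg_cong[OF Suc_times_binomial_Suc[of r "\<nu> + w - 1"], of "of_nat :: nat \<Rightarrow> complex"]
      by (simp add: u algebra_simps)
    have w: "of_nat w = (of_nat r + of_nat u + 1 :: complex)"
      using u(3) by simp
    have "coeff (lowering \<mu> \<nu> w (bracket_poly \<mu> \<nu> w)) r = (-1) ^ r * (
       - ((of_nat \<mu> + of_nat r) * of_nat ((\<mu> + w - 1) choose u))
           * ((of_nat r + 1) * of_nat ((\<nu> + w - 1) choose Suc r))
       + ((of_nat u + 1) * of_nat ((\<mu> + w - 1) choose Suc u))
           * ((of_nat \<nu> + of_nat u) * of_nat ((\<nu> + w - 1) choose r)))"
      using True unfolding coeff_lowering coeff_bracket_poly u(1,2) w
      by (simp add: algebra_simps)
    then show ?thesis
      unfolding 1 2 by (simp add: algebra_simps)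
  next
    case False
    then show ?thesis
      by (simp add: coeff_lowering coeff_bracket_poly)
  qed
qed

text \<open>At \<open>x = -1\<close> the alternating signs cancel, and the value is a Vandermonde convolution.\<close>

lemma poly_bracket_poly_minus_one:
  "poly (bracket_poly \<mu> \<nu> w) (-1)
     = of_nat ((\<mu> + w - 1 + (\<nu> + w - 1)) choose w)"
proof -
  have "poly (bracket_poly \<mu> \<nu> w) (-1)
      = (\<Sum>r\<le>w. of_nat ((\<nu> + w - 1) choose r) * of_nat ((\<mu> + w - 1) choose (w - r)))"
    unfolding bracket_poly_def poly_sum poly_monom
    by (intro sum.cong refl) (simp add: power_mult_distrib[symmetric] mult_ac)
  also have "\<dots> = of_nat ((\<nu> + w - 1 + (\<mu> + w - 1)) choose w)"
    unfolding vandermonde[symmetric] by simp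
  finally show ?thesis by (simp add: add.commute)
qed

section \<open>The coefficients of the expansion\<close>

text \<open>The inner sum of the coefficient formula, with \<open>l\<close> for \<open>m + n - w\<close> and \<open>e\<close> for \<open>n - w\<close>. As
  the last factor depends only on \<open>w\<close> and \<open>j\<close>, recurrences in \<open>m\<close> and \<open>n\<close> hold term by term;
  for this \<open>e\<close> is an integer, which may be negative.\<close>

definition bracket_sum :: "nat \<Rightarrow> nat \<Rightarrow> nat \<Rightarrow> nat \<Rightarrow> int \<Rightarrow> complex" where
  "bracket_sum \<mu> \<nu> w l e = (\<Sum>j\<le>w. (-1) ^ j * fact (l + j) * recip_fact (e + int j)
     * (fact (2 * w + \<mu> + \<nu> - j - 2) * recip_fact (int \<nu> + int w - int j - 1)
        / (fact j * fact (w - j))))"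

text \<open>With \<open>l + 1 = m + n - w\<close> and \<open>e = n - w\<close> the scalar is \<open>m\<close>, and this is the recurrence
  \<open>S(m, n) = m S(m - 1, n) + S(m, n - 1)\<close>. Each term satisfies it because \<open>l + 1 + j = (l + 1 - e) + (e + j)\<close>.\<close>

lemma bracket_sum_Suc:
  "bracket_sum \<mu> \<nu> w (Suc l) e
     = of_int (int (Suc l) - e) * bracket_sum \<mu> \<nu> w l e + bracket_sum \<mu> \<nu> w l (e - 1)"
proof -
  have "(fact (Suc l + j) * recip_fact (e + int j) :: complex)
      = of_int (int (Suc l) - e) * (fact (l + j) * recip_fact (e + int j))
        + fact (l + j) * recip_fact (e - 1 + int j)" for j
    using recip_fact_minus_one[of "e + int j"] by (simp add: algebra_simps)
  then have "(-1) ^ j * fact (Suc l + j) * recip_fact (e + int j) * X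
      = of_int (int (Suc l) - e) * ((-1) ^ j * fact (l + j) * recip_fact (e + int j) * X)
        + (-1) ^ j * fact (l + j) * recip_fact (e - 1 + int j) * X" for j and X :: complex
    by (simp only: mult.assoc) (simp add: algebra_simps)
  then show ?thesis
    unfolding bracket_sum_def by (simp only: sum_distrib_left sum.distrib)
qed

text \<open>The boundary case \<open>\<mu> = 0\<close>, \<open>m = 1\<close> of the recurrence: the scalar \<open>m (\<mu> + m - 1)\<close> of
  \<open>lowering_monom\<close> is \<open>0\<close>, whereas the summand \<open>m S(m - 1, n)\<close> of \<open>bracket_sum_Suc\<close> persists, and
  so \<open>S(0, n)\<close> must vanish. It does, as a \<open>w\<close>-th finite difference of a polynomial of degree \<open>w - 1\<close>.\<close>

lemma bracket_sum_eq_0_left: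
  assumes "1 \<le> w" "w \<le> n" "2 \<le> \<nu>"
  shows "bracket_sum 0 \<nu> w (n - w) (int n - int w) = 0"
proof -
  have "bracket_sum 0 \<nu> w (n - w) (int n - int w)
     = (\<Sum>j\<le>w. (-1) ^ j * of_nat (w choose j) * of_nat ((2 * w + \<nu> - 2 - j) choose (w - 1)))
       * (fact (w - 1) / fact w)"
    unfolding bracket_sum_def sum_distrib_right
  proof (intro sum.cong refl)
    fix j assume "j \<in> {..w}"
    then have j: "j \<le> w" by simp
    have 1: "int n - int w + int j = int (n - w + j)" 
      and 2: "int \<nu> + int w - int j - 1 = int (2 * w + \<nu> - 2 - j) - int (w - 1)"
      and 3: "2 * w + 0 + \<nu> - j - 2 = 2 * w + \<nu> - 2 - j"
      using assms j by auto
    have "(of_nat (w choose j) :: complex) = fact w / (fact j * fact (w - j))"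
      by (rule binomial_fact[OF j])
    then show "(-1) ^ j * fact (n - w + j) * recip_fact (int n - int w + int j)
     * (fact (2 * w + 0 + \<nu> - j - 2) * recip_fact (int \<nu> + int w - int j - 1)
        / (fact j * fact (w - j)))
      = (-1) ^ j * of_nat (w choose j) * of_nat ((2 * w + \<nu> - 2 - j) choose (w - 1))
         * (fact (w - 1) / fact w)"
      unfolding 1 2 3 recip_fact_nonneg fact_mult_recip_fact_diff by simp
  qed
  also have "(\<Sum>j\<le>w. (-1) ^ j * of_nat (w choose j)
      * of_nat ((2 * w + \<nu> - 2 - j) choose (w - 1))) = (0::complex)"
    by (subst alternating_binomial_sum_binomial) (use assms in auto)
  finally show ?thesis by simp
qed

text \<open>The boundary case \<open>\<nu> = 0\<close>, \<open>n = 1\<close>: every term contains the reciprocal factorial of a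
  negative integer.\<close>

lemma bracket_sum_eq_0_right:
  assumes "e \<le> - int w"
  shows "bracket_sum \<mu> 0 w l e = 0"
  unfolding bracket_sum_def
proof (intro sum.neutral ballI)
  fix j assume "j \<in> {..w}"
  then have "e + int j < 0 \<or> int 0 + int w - int j - 1 < 0"
    using assms by auto
  then show "(-1) ^ j * fact (l + j) * recip_fact (e + int j)
     * (fact (2 * w + \<mu> + 0 - j - 2) * recip_fact (int 0 + int w - int j - 1)
        / (fact j * fact (w - j))) = 0"
    by (auto simp: recip_fact_def)
qed

text \<open>The terms with \<open>j < m\<close> vanish. After the shift \<open>j = m + i\<close>, what remains is an \<open>n\<close>-th finite
  difference of a binomial coefficient.\<close>

lemma bracket_sum_top:
  assumes "1 \<le> \<mu> + m" "1 \<le> \<nu> + n" "2 \<le> \<mu> + \<nu>"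
  shows "bracket_sum \<mu> \<nu> (m + n) 0 (- int m)
     = (-1) ^ m * fact (\<mu> + m + n - 1) / fact n
       * of_nat ((m + n + \<mu> + \<nu> - 2) choose (\<mu> + m - 1))"
proof -
  define M where "M = m + 2 * n + \<mu> + \<nu> - 2"
  have "bracket_sum \<mu> \<nu> (m + n) 0 (- int m)
     = (\<Sum>j\<in>{m..m + n}. (-1) ^ j * fact (0 + j) * recip_fact (- int m + int j)
     * (fact (2 * (m + n) + \<mu> + \<nu> - j - 2) * recip_fact (int \<nu> + int (m + n) - int j - 1)
        / (fact j * fact (m + n - j))))"
    unfolding bracket_sum_def
    by (rule sum.mono_neutral_right) (auto simp: recip_fact_def)
  also have "\<dots> = (\<Sum>i\<le>n. (-1) ^ (m + i) * fact (m + i) * recip_fact (- int m + int (m + i))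
     * (fact (2 * (m + n) + \<mu> + \<nu> - (m + i) - 2) * recip_fact (int \<nu> + int (m + n) - int (m + i) - 1)
        / (fact (m + i) * fact (m + n - (m + i)))))"
    by (rule sum.reindex_bij_witness[of _ "\<lambda>i. m + i" "\<lambda>j. j - m"]) auto
  also have "\<dots> = (\<Sum>i\<le>n. (-1) ^ i * of_nat (n choose i) * of_nat ((M - i) choose (\<mu> + m + n - 1)))
       * ((-1) ^ m * fact (\<mu> + m + n - 1) / fact n)"
    unfolding sum_distrib_right
  proof (intro sum.cong refl)
    fix i assume "i \<in> {..n}"
    then have i: "i \<le> n" by simp
    have 1: "- int m + int (m + i) = int i"
      and 2: "int \<nu> + int (m + n) - int (m + i) - 1 = int (M - i) - int (\<mu> + m + n - 1)"
      and 3: "2 * (m + n) + \<mu> + \<nu> - (m + i) - 2 = M - i"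
      and 4: "m + n - (m + i) = n - i"
      using assms i by (auto simp: M_def)
    have "(of_nat (n choose i) :: complex) = fact n / (fact i * fact (n - i))"
      by (rule binomial_fact[OF i])
    then show "(-1) ^ (m + i) * fact (m + i) * recip_fact (- int m + int (m + i))
     * (fact (2 * (m + n) + \<mu> + \<nu> - (m + i) - 2) * recip_fact (int \<nu> + int (m + n) - int (m + i) - 1)
        / (fact (m + i) * fact (m + n - (m + i))))
      = (-1) ^ i * of_nat (n choose i) * of_nat ((M - i) choose (\<mu> + m + n - 1))
         * ((-1) ^ m * fact (\<mu> + m + n - 1) / fact n)"
      unfolding 1 2 3 4 recip_fact_nonneg fact_mult_recip_fact_diff
      by (simp add: power_add field_simps)
  qed
  also have "(\<Sum>i\<le>n. (-1) ^ i * of_nat (n choose i) * of_nat ((M - i) choose (\<mu> + m + n - 1)))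
      = (of_nat ((m + n + \<mu> + \<nu> - 2) choose (\<mu> + m - 1)) :: complex)"
  proof -
    have "n \<le> M" "n \<le> \<mu> + m + n - 1" "M - n = m + n + \<mu> + \<nu> - 2" "\<mu> + m + n - 1 - n = \<mu> + m - 1"
      using assms by (auto simp: M_def)
    then show ?thesis
      by (subst alternating_binomial_sum_binomial) auto
  qed
  finally show ?thesis by simp
qed

text \<open>The coefficient of the theorem without its factor \<open>(2\<pi>i/h)\<^sup>l\<close>, indexed by \<open>w = m + n - l\<close>, the
  parameter that stays fixed in the recurrence.\<close>

definition bracket_coeff :: "nat \<Rightarrow> nat \<Rightarrow> nat \<Rightarrow> nat \<Rightarrow> nat \<Rightarrow> complex" where
  "bracket_coeff \<mu> \<nu> m n w =
     of_nat (\<mu> + \<nu> + 2 * w - 1) * fact w * recip_fact (int \<mu> + int w - 1)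
       * (fact n * fact (\<mu> + m - 1) * fact (\<nu> + n - 1))
       / (fact (m + n - w) * fact (\<mu> + \<nu> + m + n + w - 1))
       * bracket_sum \<mu> \<nu> w (m + n - w) (int n - int w)"

text \<open>The scalars are those of \<open>lowering_monom\<close> and \<open>lowering_power\<close>. Once the factorials are cancelled,
  the statement is \<open>bracket_sum_Suc\<close>, except in the two boundary cases \<open>\<mu> + m = 1\<close> and
  \<open>\<nu> + n = 1\<close>, where the cancellation \<open>(\<mu> + m - 1)! = (\<mu> + m - 1) (\<mu> + m - 2)!\<close> or its
  analogue for \<open>\<nu> + n\<close> is not available.\<close>

lemma bracket_coeff_recurrence:
  assumes "w < m + n" "1 \<le> \<mu> + m" "1 \<le> \<nu> + n" "2 \<le> \<mu> + \<nu>"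
  shows "of_nat (m * (\<mu> + m - 1)) * bracket_coeff \<mu> \<nu> (m - 1) n w
       + of_nat (n * (\<nu> + n - 1)) * bracket_coeff \<mu> \<nu> m (n - 1) w
     = of_nat ((m + n - w) * (\<mu> + \<nu> + m + n + w - 1)) * bracket_coeff \<mu> \<nu> m n w"
proof -
  define l where "l = m + n - w - 1"
  \<comment> \<open>\<open>l + 1\<close> and \<open>Q + 1\<close> are the arguments of the factorials in the denominator for \<open>(m, n)\<close>, and \<open>l\<close>
    and \<open>Q\<close> those for \<open>(m - 1, n)\<close> and \<open>(m, n - 1)\<close>.\<close>
  define Q where "Q = \<mu> + \<nu> + m + n + w - 2"
  define c :: complex where
    "c = of_nat (\<mu> + \<nu> + 2 * w - 1) * fact w * recip_fact (int \<mu> + int w - 1)"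
  define g :: complex where "g = fact n * fact (\<mu> + m - 1) * fact (\<nu> + n - 1)"
  define e where "e = int n - int w"
  have l: "m + n - w = Suc l" and Q: "\<mu> + \<nu> + m + n + w - 1 = Suc Q"
    and le: "int (Suc l) - e = int m"
    using assms by (auto simp: l_def Q_def e_def)
  have A: "bracket_coeff \<mu> \<nu> m n w
      = c * g / (fact (Suc l) * fact (Suc Q)) * bracket_sum \<mu> \<nu> w (Suc l) e"
    unfolding bracket_coeff_def c_def g_def e_def l Q ..
  have L: "of_nat (m * (\<mu> + m - 1)) * bracket_coeff \<mu> \<nu> (m - 1) n w
      = c * g / (fact l * fact Q) * (of_nat m * bracket_sum \<mu> \<nu> w l e)"
  proof (cases "m = 0")
    case False
    have 1: "m - 1 + n - w = l" "\<mu> + \<nu> + (m - 1) + n + w - 1 = Q"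
      using False assms by (auto simp: l_def Q_def)
    show ?thesis
    proof (cases "\<mu> + m = 1")
      case True
      \<comment> \<open>Here \<open>\<mu> = 0\<close> and \<open>m = 1\<close>; for \<open>w = 0\<close> the factor \<open>1/(\<mu> + w - 1)!\<close> in \<open>c\<close> is \<open>0\<close>.\<close>
      have "c * bracket_sum \<mu> \<nu> w l e = 0"
      proof (cases "w = 0")
        case True
        then show ?thesis using \<open>\<mu> + m = 1\<close> False by (simp add: c_def recip_fact_def)
      next
        case w: False
        have "bracket_sum 0 \<nu> w (n - w) (int n - int w) = 0"
          by (rule bracket_sum_eq_0_left) (use w True False assms in auto)
        moreover have "\<mu> = 0" "l = n - w" using True False by (auto simp: l_def)
        ultimately show ?thesis by (simp add: e_def)
      qed
      then show ?thesis using True by auto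
    next
      case 2: False
      have "fact (\<mu> + m - 1) = (of_nat (\<mu> + m - 1) * fact (\<mu> + (m - 1) - 1) :: complex)"
        using 2 False assms by (subst fact_reduce) auto
      then show ?thesis
        unfolding bracket_coeff_def c_def g_def e_def 1 by simp
    qed
  qed simp
  have R: "of_nat (n * (\<nu> + n - 1)) * bracket_coeff \<mu> \<nu> m (n - 1) w
      = c * g / (fact l * fact Q) * bracket_sum \<mu> \<nu> w l (e - 1)"
  proof (cases "n = 0")
    case True
    have "bracket_sum \<mu> \<nu> w l (e - 1) = 0"
      unfolding bracket_sum_def
      by (rule sum.neutral) (use True in \<open>auto simp: recip_fact_def e_def\<close>)
    then show ?thesis using True by simp
  next
    case False
    have 1: "m + (n - 1) - w = l" "\<mu> + \<nu> + m + (n - 1) + w - 1 = Q" "int (n - 1) - int w = e - 1"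
      using False assms by (auto simp: l_def Q_def e_def)
    show ?thesis
    proof (cases "\<nu> + n = 1")
      case True
      then have "\<nu> = 0" "e - 1 \<le> - int w" using False by (auto simp: e_def)
      then show ?thesis using True bracket_sum_eq_0_right by simp
    next
      case 2: False
      have "fact (\<nu> + n - 1) = (of_nat (\<nu> + n - 1) * fact (\<nu> + (n - 1) - 1) :: complex)"
        using 2 False assms by (subst fact_reduce) auto
      moreover have "fact n = (of_nat n * fact (n - 1) :: complex)"
        using False by (subst fact_reduce) auto
      ultimately show ?thesis
        unfolding bracket_coeff_def c_def g_def 1 by simp
    qed
  qed
  have "of_nat (Suc l * Suc Q) * bracket_coeff \<mu> \<nu> m n w
      = c * g / (fact l * fact Q) * bracket_sum \<mu> \<nu> w (Suc l) e"
    unfolding A fact_Suc of_nat_mult by (simp add: field_simps del: of_nat_Suc)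
  also have "\<dots> = c * g / (fact l * fact Q) * (of_nat m * bracket_sum \<mu> \<nu> w l e)
      + c * g / (fact l * fact Q) * bracket_sum \<mu> \<nu> w l (e - 1)"
    unfolding bracket_sum_Suc le by (simp add: distrib_left)
  finally show ?thesis
    unfolding L R l Q by simp
qed

text \<open>On \<open>x + y = 0\<close> only the term with \<open>w = m + n\<close> of the expansion survives; this is the expansion at
  the point \<open>(-1, 1)\<close>.\<close>

lemma bracket_coeff_top:
  assumes "1 \<le> \<mu> + m" "1 \<le> \<nu> + n" "2 \<le> \<mu> + \<nu>"
  shows "bracket_coeff \<mu> \<nu> m n (m + n) * poly (bracket_poly \<mu> \<nu> (m + n)) (-1) = (-1) ^ m"
proof -
  define N where "N = m + n"
  define K where "K = N + \<mu> + \<nu> - 2"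
  have choose: "of_nat (K choose (\<mu> + m - 1))
      = (fact K / (fact (\<mu> + m - 1) * fact (\<nu> + n - 1)) :: complex)"
  proof -
    have "\<mu> + m - 1 \<le> K" "K - (\<mu> + m - 1) = \<nu> + n - 1"
      using assms by (auto simp: K_def N_def)
    then show ?thesis by (simp add: binomial_fact)
  qed
  have eval: "of_nat ((\<mu> + N - 1 + (\<nu> + N - 1)) choose N)
      = (fact (K + N) / (fact N * fact K) :: complex)"
  proof (cases "N = 0")
    case False
    then have "\<mu> + N - 1 + (\<nu> + N - 1) = K + N"
      using assms by (auto simp: K_def)
    then show ?thesis by (simp add: binomial_fact)
  qed simp
  have 1: "int \<mu> + int N - 1 = int (\<mu> + N - 1)" "N - N = 0" "int n - int N = - int m"
    "\<mu> + \<nu> + m + n + N - 1 = Suc (K + N)" "\<mu> + \<nu> + 2 * N - 1 = Suc (K + N)"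
    "N + \<mu> + \<nu> - 2 = K" "\<mu> + m + n - 1 = \<mu> + N - 1"
    using assms by (auto simp: N_def K_def)
  have "bracket_coeff \<mu> \<nu> m n N
      = (-1) ^ m * fact N * fact K / fact (K + N)"
    unfolding bracket_coeff_def N_def[symmetric] 1 recip_fact_nonneg
      bracket_sum_top[OF assms, unfolded N_def[symmetric] 1] choose
    by (simp add: field_simps del: of_nat_Suc)
  then show ?thesis
    unfolding N_def[symmetric] poly_bracket_poly_minus_one eval by simp
qed

text \<open>Induction on the degree: the difference of the two sides is killed by the lowering operator and
  vanishes at \<open>-1\<close>. A zero scalar in front of the identity for \<open>(m - 1, n)\<close> or \<open>(m, n - 1)\<close> occurs
  exactly where that identity is outside the range of the induction hypothesis.\<close>

theorem monom_eq_sum_bracket_poly: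
  assumes "1 \<le> \<mu> + m" "1 \<le> \<nu> + n" "2 \<le> \<mu> + \<nu>"
  shows "monom 1 m = (\<Sum>w\<le>m + n. smult (bracket_coeff \<mu> \<nu> m n w)
            ([:1, 1:] ^ (m + n - w) * bracket_poly \<mu> \<nu> w))"
  using assms(1,2)
proof (induction "m + n" arbitrary: m n rule: less_induct)
  case less
  define N where "N = m + n"
  define S where "S m n M = (\<Sum>w\<le>M. smult (bracket_coeff \<mu> \<nu> m n w)
            ([:1, 1:] ^ (M - w) * bracket_poly \<mu> \<nu> w))" for m n M
  have deg: "degree ([:1, 1:] ^ (N - w) * bracket_poly \<mu> \<nu> w) \<le> N" if "w \<le> N" for w
  proof -
    have "degree ([:1, 1:] ^ (N - w) * bracket_poly \<mu> \<nu> w)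
        \<le> degree ([:1, 1 :: complex:] ^ (N - w)) + degree (bracket_poly \<mu> \<nu> w)"
      by (rule degree_mult_le)
    also have "\<dots> \<le> (N - w) + w"
      using degree_bracket_poly[of \<mu> \<nu> w] by (intro add_mono) (auto simp: degree_power_eq)
    finally show ?thesis using that by simp
  qed
  have deg_S: "degree (S m n N) \<le> N"
    unfolding S_def by (intro degree_sum_le order_trans[OF degree_smult_le] deg) auto
  have lower: "lowering \<mu> \<nu> N (S m n N) = lowering \<mu> \<nu> N (monom 1 m)"
  proof (cases N)
    case 0
    then show ?thesis
      by (simp add: N_def S_def lowering_smult lowering_bracket_poly, simp add: lowering_def)
  next
    case (Suc M)
    have step: "lowering \<mu> \<nu> N (smult (bracket_coeff \<mu> \<nu> m n w)
          ([:1, 1:] ^ (N - w) * bracket_poly \<mu> \<nu> w))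
        = smult (of_nat (m * (\<mu> + m - 1)) * bracket_coeff \<mu> \<nu> (m - 1) n w
            + of_nat (n * (\<nu> + n - 1)) * bracket_coeff \<mu> \<nu> m (n - 1) w)
              ([:1, 1:] ^ (M - w) * bracket_poly \<mu> \<nu> w)" if "w \<le> M" for w
    proof -
      have 1: "N - w = Suc (M - w)" "N = w + Suc (M - w)" using that Suc by auto
      have 2: "Suc (M - w) * (\<mu> + \<nu> + 2 * w + (M - w))
          = (m + n - w) * (\<mu> + \<nu> + m + n + w - 1)"
        using that Suc assms(3) by (intro arg_cong2[of _ _ _ _ "(*)"]) (auto simp: N_def)
      have "lowering \<mu> \<nu> N ([:1, 1:] ^ (N - w) * bracket_poly \<mu> \<nu> w)
          = lowering \<mu> \<nu> (w + Suc (M - w)) ([:1, 1:] ^ Suc (M - w) * bracket_poly \<mu> \<nu> w)"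
        using 1 by simp
      also have "\<dots> = smult (of_nat ((m + n - w) * (\<mu> + \<nu> + m + n + w - 1)))
              ([:1, 1:] ^ (M - w) * bracket_poly \<mu> \<nu> w)"
        unfolding lowering_power lowering_bracket_poly 2 by simp
      finally have 3: "lowering \<mu> \<nu> N ([:1, 1:] ^ (N - w) * bracket_poly \<mu> \<nu> w) = \<dots>" .
      have "w < m + n" using that Suc by (simp add: N_def)
      then show ?thesis
        by (simp only: bracket_coeff_recurrence[OF _ less.prems assms(3)] lowering_smult 3
            smult_smult, simp only: mult.commute)
    qed
    have IH1: "smult (of_nat (m * (\<mu> + m - 1))) (S (m - 1) n M)
        = smult (of_nat (m * (\<mu> + m - 1))) (monom 1 (m - 1))"
    proof (cases "m * (\<mu> + m - 1) = 0")
      case False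
      then have "m - 1 + n = M" using Suc by (auto simp: N_def)
      then show ?thesis
        using less.hyps[of "m - 1" n] False less.prems by (auto simp: S_def N_def)
    qed (simp only: of_nat_0 smult_0_left)
    have IH2: "smult (of_nat (n * (\<nu> + n - 1))) (S m (n - 1) M)
        = smult (of_nat (n * (\<nu> + n - 1))) (monom 1 m)"
    proof (cases "n * (\<nu> + n - 1) = 0")
      case False
      then have "m + (n - 1) = M" using Suc by (auto simp: N_def)
      then show ?thesis
        using less.hyps[of m "n - 1"] False less.prems by (auto simp: S_def N_def)
    qed (simp only: of_nat_0 smult_0_left)
    have "lowering \<mu> \<nu> N (S m n N)
      = (\<Sum>w\<le>M. lowering \<mu> \<nu> N (smult (bracket_coeff \<mu> \<nu> m n w)
          ([:1, 1:] ^ (N - w) * bracket_poly \<mu> \<nu> w)))"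
      using lowering_bracket_poly[of \<mu> \<nu> N] by (simp add: S_def lowering_sum lowering_add Suc lowering_smult)
    also have "\<dots> = (\<Sum>w\<le>M. smult (of_nat (m * (\<mu> + m - 1)) * bracket_coeff \<mu> \<nu> (m - 1) n w
            + of_nat (n * (\<nu> + n - 1)) * bracket_coeff \<mu> \<nu> m (n - 1) w)
              ([:1, 1:] ^ (M - w) * bracket_poly \<mu> \<nu> w))"
      by (intro sum.cong refl step) simp
    also have "\<dots> = smult (of_nat (m * (\<mu> + m - 1))) (S (m - 1) n M)
        + smult (of_nat (n * (\<nu> + n - 1))) (S m (n - 1) M)"
      unfolding S_def smult_sum_right sum.distrib[symmetric] by (simp only: smult_add_left smult_smult)
    also have "\<dots> = lowering \<mu> \<nu> N (monom 1 m)"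
      unfolding IH1 IH2 N_def lowering_monom ..
    finally show ?thesis .
  qed
  have "monom 1 m - S m n N = 0"
  proof (rule lowering_eq_0_imp_eq_0)
    show "lowering \<mu> \<nu> N (monom 1 m - S m n N) = 0"
      by (simp add: lowering_diff lower)
    have "poly (S m n N) (-1) = bracket_coeff \<mu> \<nu> m n N * poly (bracket_poly \<mu> \<nu> N) (-1)"
    proof -
      have "poly (S m n N) (-1) = (\<Sum>w\<le>N. if w = N
          then bracket_coeff \<mu> \<nu> m n N * poly (bracket_poly \<mu> \<nu> N) (-1) else 0)"
        unfolding S_def poly_sum by (intro sum.cong refl) (auto simp: poly_power)
      then show ?thesis by simp
    qed
    also have "\<dots> = (-1) ^ m"
      unfolding N_def by (rule bracket_coeff_top) (use less.prems assms in auto)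
    finally show "poly (monom 1 m - S m n N) (-1) = 0"
      by (simp add: poly_monom)
    show "degree (monom 1 m - S m n N) \<le> N"
      by (intro degree_diff_le deg_S) (auto simp: N_def degree_monom_eq)
  qed (rule assms)
  then show ?case
    by (simp add: S_def N_def)
qed

section \<open>The identity between binary forms\<close>

definition homogenize :: "nat \<Rightarrow> complex poly \<Rightarrow> complex \<Rightarrow> complex \<Rightarrow> complex" where
  "homogenize N p x y = (\<Sum>r\<le>N. coeff p r * x ^ r * y ^ (N - r))"

lemma homogenize_smult: "homogenize N (smult c p) x y = c * homogenize N p x y"
  by (simp add: homogenize_def sum_distrib_left mult.assoc)

lemma homogenize_sum: "homogenize N (\<Sum>i\<in>I. p i) x y = (\<Sum>i\<in>I. homogenize N (p i) x y)"
  unfolding homogenize_def coeff_sum sum_distrib_right by (rule sum.swap)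

lemma homogenize_monom: "homogenize (m + n) (monom 1 m) x y = x ^ m * y ^ n"
proof -
  have "homogenize (m + n) (monom 1 m) x y = (\<Sum>r\<le>m + n. if r = m then x ^ m * y ^ n else 0)"
    unfolding homogenize_def by (intro sum.cong refl) auto
  then show ?thesis by simp
qed

lemma homogenize_Suc:
  assumes "degree p \<le> N"
  shows "homogenize (Suc N) ([:1, 1:] * p) x y = (x + y) * homogenize N p x y"
proof -
  have "homogenize (Suc N) ([:1, 1:] * p) x y
      = (\<Sum>r\<le>Suc N. coeff p r * x ^ r * y ^ (Suc N - r))
        + (\<Sum>r\<le>Suc N. coeff (pCons 0 p) r * x ^ r * y ^ (Suc N - r))"
    unfolding homogenize_def sum.distrib[symmetric]
    by (intro sum.cong refl) (simp add: algebra_simps)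
  also have "(\<Sum>r\<le>Suc N. coeff p r * x ^ r * y ^ (Suc N - r)) = y * homogenize N p x y"
  proof -
    have "coeff p (Suc N) = 0"
      using assms by (intro coeff_eq_0) simp
    then show ?thesis
      by (simp add: homogenize_def sum_distrib_left Suc_diff_le mult_ac)
  qed
  also have "(\<Sum>r\<le>Suc N. coeff (pCons 0 p) r * x ^ r * y ^ (Suc N - r)) = x * homogenize N p x y"
    by (subst sum.atMost_Suc_shift) (simp add: homogenize_def sum_distrib_left mult_ac)
  finally show ?thesis by (simp add: algebra_simps)
qed

lemma homogenize_power:
  assumes "degree p \<le> N"
  shows "homogenize (N + k) ([:1, 1:] ^ k * p) x y = (x + y) ^ k * homogenize N p x y"
proof (induction k)
  case (Suc k)
  have "degree ([:1, 1:] ^ k * p) \<le> degree ([:1, 1 :: complex:] ^ k) + degree p"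
    by (rule degree_mult_le)
  also have "\<dots> \<le> N + k"
    using assms by (simp add: degree_power_eq)
  finally have "homogenize (Suc (N + k)) ([:1, 1:] * ([:1, 1:] ^ k * p)) x y
      = (x + y) * homogenize (N + k) ([:1, 1:] ^ k * p) x y"
    by (rule homogenize_Suc)
  then show ?case
    unfolding Suc.IH by (simp only: power_Suc mult.assoc add_Suc_right)
qed simp

definition bracket_form :: "nat \<Rightarrow> nat \<Rightarrow> nat \<Rightarrow> complex \<Rightarrow> complex \<Rightarrow> complex" where
  "bracket_form \<mu> \<nu> w x y = (\<Sum>r\<le>w. (-1) ^ r * of_nat ((\<mu> + w - 1) choose (w - r))
     * of_nat ((\<nu> + w - 1) choose r) * x ^ r * y ^ (w - r))"

theorem monomial_eq_sum_bracket_form: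
  assumes "1 \<le> \<mu> + m" "1 \<le> \<nu> + n" "2 \<le> \<mu> + \<nu>"
  shows "x ^ m * y ^ n = (\<Sum>l\<le>m + n. bracket_coeff \<mu> \<nu> m n (m + n - l)
           * (x + y) ^ l * bracket_form \<mu> \<nu> (m + n - l) x y)"
proof -
  have form: "homogenize w (bracket_poly \<mu> \<nu> w) x y = bracket_form \<mu> \<nu> w x y" for w
    unfolding homogenize_def bracket_form_def by (intro sum.cong refl) (simp add: coeff_bracket_poly)
  have "x ^ m * y ^ n = homogenize (m + n) (monom 1 m) x y"
    by (simp add: homogenize_monom)
  also have "\<dots> = (\<Sum>w\<le>m + n. bracket_coeff \<mu> \<nu> m n w
      * homogenize (m + n) ([:1, 1:] ^ (m + n - w) * bracket_poly \<mu> \<nu> w) x y)"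
    unfolding monom_eq_sum_bracket_poly[OF assms] homogenize_sum homogenize_smult ..
  also have "\<dots> = (\<Sum>w\<le>m + n. bracket_coeff \<mu> \<nu> m n w
      * (x + y) ^ (m + n - w) * bracket_form \<mu> \<nu> w x y)"
  proof (intro sum.cong refl)
    fix w assume "w \<in> {..m + n}"
    then have "w + (m + n - w) = m + n" by simp
    then show "bracket_coeff \<mu> \<nu> m n w
        * homogenize (m + n) ([:1, 1:] ^ (m + n - w) * bracket_poly \<mu> \<nu> w) x y
      = bracket_coeff \<mu> \<nu> m n w * (x + y) ^ (m + n - w) * bracket_form \<mu> \<nu> w x y"
      using homogenize_power[OF degree_bracket_poly, of w "m + n - w" \<mu> \<nu> x y] by (simp add: form)
  qed
  also have "\<dots> = (\<Sum>l\<le>m + n. bracket_coeff \<mu> \<nu> m n (m + n - l)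
           * (x + y) ^ l * bracket_form \<mu> \<nu> (m + n - l) x y)"
    by (rule sum.reindex_bij_witness[of _ "\<lambda>l. m + n - l" "\<lambda>w. m + n - w"]) auto
  finally show ?thesis .
qed

lemma rc_coeff_eq:
  assumes "l \<le> m + n"
  shows "rc_coeff \<mu> \<nu> m n h l
    = (2 * of_real pi * \<i> / of_real h) ^ l * bracket_coeff \<mu> \<nu> m n (m + n - l)"
proof -
  define w where "w = m + n - l"
  have l: "l = m + n - w" and w: "m + n - l = w" "\<mu> + \<nu> + 2 * m + 2 * n - l - 1 = \<mu> + \<nu> + m + n + w - 1"
    using assms by (auto simp: w_def)
  have "(\<Sum>j=0..w. (-1) ^ j * fact (m + n - w + j) * fact (2 * w + \<mu> + \<nu> - j - 2)
          / (fact j * fact (w - j))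
          * recip_fact (int n - int w + int j)
          * recip_fact (int \<nu> + int w - int j - 1))
      = bracket_sum \<mu> \<nu> w (m + n - w) (int n - int w)"
    unfolding bracket_sum_def atLeast0AtMost by (intro sum.cong refl) (simp add: mult_ac)
  then show ?thesis
    unfolding rc_coeff_def Let_def w bracket_coeff_def l[symmetric]
    by (simp add: power_divide mult_ac)
qed

section \<open>Fourier expansions as power series\<close>

lemma mem_upper_half_plane: "z \<in> upper_half_plane \<longleftrightarrow> Im z > 0"
  by (simp add: upper_half_plane_def)

lemma open_upper_half_plane: "open upper_half_plane"
  unfolding upper_half_plane_def by (rule open_halfspace_Im_gt)

definition nome :: "real \<Rightarrow> complex \<Rightarrow> complex" where
  "nome h z = exp (2 * of_real pi * \<i> * z / of_real h)"

lemma norm_nome: "norm (nome h z) = exp (- (2 * pi * Im z / h))"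
  by (simp add: nome_def)

lemma nome_has_field_derivative:
  assumes "h \<noteq> 0"
  shows "(nome h has_field_derivative 2 * of_real pi * \<i> / of_real h * nome h z) (at z)"
  unfolding nome_def by (auto intro!: derivative_eq_intros simp: assms)

lemma has_fourier_expansion_iff:
  "has_fourier_expansion h F a
     \<longleftrightarrow> (\<forall>z\<in>upper_half_plane. (\<lambda>k. a k * nome h z ^ k) sums F z)"
proof -
  have "exp (2 * of_real pi * \<i> * of_nat k * z / of_real h) = nome h z ^ k" for k z
    unfolding nome_def exp_of_nat_mult[symmetric] by (simp add: mult_ac)
  then show ?thesis
    by (simp add: has_fourier_expansion_def)
qed

text \<open>The expansion converges on the whole half plane, hence at a point \<open>q\<close> of larger modulus than any
  given one: move \<open>z\<close> down if \<open>h > 0\<close> and up if \<open>h < 0\<close>.\<close>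

lemma exists_larger_nome:
  assumes "h \<noteq> 0" "z \<in> upper_half_plane"
  obtains z' where "z' \<in> upper_half_plane" "norm (nome h z) < norm (nome h z')"
proof -
  define y where "y = (if h > 0 then Im z / 2 else 2 * Im z)"
  have "y > 0" "y / h < Im z / h"
    using assms by (auto simp: y_def mem_upper_half_plane divide_simps)
  then have "norm (nome h z) < norm (nome h (Complex 0 y))"
    by (simp add: norm_nome mult_less_cancel_left_pos times_divide_eq_right[symmetric]
        del: times_divide_eq_right)
  then show ?thesis
    using that[of "Complex 0 y"] \<open>y > 0\<close> by (simp add: mem_upper_half_plane)
qed

text \<open>Every value of \<open>q\<close> on the half plane lies strictly inside the disc of convergence, so that the power
  series may be differentiated term by term and multiplied.\<close>

lemma fourier_expansion_inside:
  assumes "h \<noteq> 0" "has_fourier_expansion h F a" "z \<in> upper_half_plane"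
  obtains K where "summable (\<lambda>k. a k * K ^ k)" "norm (nome h z) < norm K"
  using exists_larger_nome[OF assms(1,3)] assms(2)
  unfolding has_fourier_expansion_iff by (metis sums_summable)

lemma fourier_expansion_abs_summable:
  assumes "h \<noteq> 0" "has_fourier_expansion h F a" "z \<in> upper_half_plane"
  shows "summable (\<lambda>k. norm (a k * nome h z ^ k))"
  using fourier_expansion_inside[OF assms] powser_insidea by metis

lemma fourier_expansion_deriv:
  assumes "h \<noteq> 0" "has_fourier_expansion h F a"
  shows "has_fourier_expansion h (deriv F) (\<lambda>k. 2 * of_real pi * \<i> / of_real h * of_nat k * a k)"
  unfolding has_fourier_expansion_iff
proof
  fix z assume z: "z \<in> upper_half_plane"
  define c :: complex where "c = 2 * of_real pi * \<i> / of_real h"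
  define f where "f q = (\<Sum>k. a k * q ^ k)" for q
  obtain K where K: "summable (\<lambda>k. a k * K ^ k)" "norm (nome h z) < norm K"
    using fourier_expansion_inside[OF assms z] .
  have "((\<lambda>z. f (nome h z)) has_field_derivative
      (\<Sum>k. diffs a k * nome h z ^ k) * (c * nome h z)) (at z)"
    unfolding f_def c_def
    by (rule DERIV_chain2[OF termdiffs_strong[OF K] nome_has_field_derivative[OF assms(1)]])
  then have "(F has_field_derivative (\<Sum>k. diffs a k * nome h z ^ k) * (c * nome h z)) (at z)"
  proof (rule has_field_derivative_transform_within_open[OF _ open_upper_half_plane z])
    show "f (nome h x) = F x" if "x \<in> upper_half_plane" for x
      using assms(2) that unfolding has_fourier_expansion_iff f_def by (metis sums_unique)
  qed
  then have deriv: "deriv F z = (\<Sum>k. diffs a k * nome h z ^ k) * (c * nome h z)"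
    by (rule DERIV_imp_deriv)
  have "summable (\<lambda>k. diffs a k * nome h z ^ k)"
    using K by (intro termdiff_converges[of _ "norm K"]) (auto intro: powser_inside)
  then have "(\<lambda>k. diffs a k * nome h z ^ k * (c * nome h z)) sums deriv F z"
    unfolding deriv by (intro sums_mult2 summable_sums)
  then have "(\<lambda>k. c * of_nat (Suc k) * a (Suc k) * nome h z ^ Suc k) sums deriv F z"
    by (simp add: diffs_def mult_ac)
  then show "(\<lambda>k. 2 * of_real pi * \<i> / of_real h * of_nat k * a k * nome h z ^ k) sums deriv F z"
    unfolding c_def[symmetric] by (subst (asm) sums_Suc_iff) simp
qed

lemma fourier_expansion_higher_deriv:
  assumes "h \<noteq> 0" "has_fourier_expansion h F a"
  shows "has_fourier_expansion h ((deriv ^^ m) F)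
    (\<lambda>k. (2 * of_real pi * \<i> / of_real h * of_nat k) ^ m * a k)"
proof (induction m)
  case (Suc m)
  show ?case
    using fourier_expansion_deriv[OF assms(1) Suc.IH] by (simp add: mult_ac)
qed (simp add: assms)

lemma fourier_expansion_mult:
  assumes "h \<noteq> 0" "has_fourier_expansion h F a" "has_fourier_expansion h G b"
  shows "has_fourier_expansion h (\<lambda>z. F z * G z) (\<lambda>k. \<Sum>i\<le>k. a i * b (k - i))"
  unfolding has_fourier_expansion_iff
proof
  fix z assume z: "z \<in> upper_half_plane"
  have "(\<lambda>k. \<Sum>i\<le>k. (a i * nome h z ^ i) * (b (k - i) * nome h z ^ (k - i)))
      sums ((\<Sum>k. a k * nome h z ^ k) * (\<Sum>k. b k * nome h z ^ k))"
    using assms z by (intro Cauchy_product_sums fourier_expansion_abs_summable)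
  also have "(\<Sum>k. a k * nome h z ^ k) = F z"
    using assms(2) z unfolding has_fourier_expansion_iff by (metis sums_unique)
  also have "(\<Sum>k. b k * nome h z ^ k) = G z"
    using assms(3) z unfolding has_fourier_expansion_iff by (metis sums_unique)
  also have "(\<lambda>k. \<Sum>i\<le>k. (a i * nome h z ^ i) * (b (k - i) * nome h z ^ (k - i)))
      = (\<lambda>k. (\<Sum>i\<le>k. a i * b (k - i)) * nome h z ^ k)"
    unfolding sum_distrib_right
    by (intro ext sum.cong refl) (simp add: mult_ac power_add[symmetric])
  finally show "(\<lambda>k. (\<Sum>i\<le>k. a i * b (k - i)) * nome h z ^ k) sums (F z * G z)" .
qed

lemma fourier_expansion_cmult:
  "has_fourier_expansion h F a \<Longrightarrow> has_fourier_expansion h (\<lambda>z. c * F z) (\<lambda>k. c * a k)"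
  unfolding has_fourier_expansion_iff by (auto simp: mult.assoc intro: sums_mult)

lemma fourier_expansion_diff:
  "has_fourier_expansion h F a \<Longrightarrow> has_fourier_expansion h G b \<Longrightarrow>
     has_fourier_expansion h (\<lambda>z. F z - G z) (\<lambda>k. a k - b k)"
  unfolding has_fourier_expansion_iff by (auto simp: left_diff_distrib intro: sums_diff)

lemma fourier_expansion_sum:
  "(\<And>i. i \<in> I \<Longrightarrow> has_fourier_expansion h (F i) (a i)) \<Longrightarrow>
     has_fourier_expansion h (\<lambda>z. \<Sum>i\<in>I. F i z) (\<lambda>k. \<Sum>i\<in>I. a i k)"
  unfolding has_fourier_expansion_iff sum_distrib_right by (auto intro: sums_sum)

text \<open>One period of the horizontal line \<open>Im z = y\<close> covers a circle in the \<open>q\<close>-plane.\<close>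

lemma exists_nome_eq:
  assumes "h \<noteq> 0" "norm q = exp (- (2 * pi * y / h))"
  obtains z where "nome h z = q" "Im z = y" "\<bar>Re z\<bar> \<le> \<bar>h\<bar>"
proof -
  define t where "t = Arg q"
  define z where "z = Complex (h * t / (2 * pi)) y"
  have q: "q \<noteq> 0" using assms(2) by auto
  have "nome h z = q"
  proof -
    have "2 * of_real pi * \<i> * z / of_real h = of_real (- (2 * pi * y / h)) + \<i> * of_real t"
      using assms(1) by (simp add: z_def complex_eq_iff Re_divide_of_real Im_divide_of_real)
    then have "nome h z = of_real (norm q) * exp (\<i> * of_real t)"
      unfolding nome_def by (simp only: exp_add assms(2) exp_of_real)
    then show ?thesis
      using Arg_eq[OF q] by (simp add: t_def)
  qed
  moreover have "\<bar>Re z\<bar> \<le> \<bar>h\<bar>"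
  proof -
    have "\<bar>t\<bar> \<le> 2 * pi"
      using mpi_less_Arg[of q] Arg_le_pi[of q] pi_gt_zero unfolding t_def by linarith
    then have "\<bar>h\<bar> * \<bar>t\<bar> \<le> \<bar>h\<bar> * (2 * pi)"
      by (intro mult_left_mono) auto
    then show ?thesis
      by (simp add: z_def abs_mult divide_simps)
  qed
  ultimately show ?thesis
    using that[of z] by (simp add: z_def)
qed

text \<open>Cauchy's inequality for the power series in \<open>q\<close>, on the circle that is the image of \<open>Im z = y\<close>.\<close>

lemma fourier_coeff_bound:
  assumes "h \<noteq> 0" "has_fourier_expansion h F a" "y > 0"
    and B: "\<And>z. Im z = y \<Longrightarrow> \<bar>Re z\<bar> \<le> \<bar>h\<bar> \<Longrightarrow> norm (F z) \<le> B"
  shows "norm (a k) \<le> B * exp (2 * pi * real k * y / h)"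
proof -
  define r where "r = exp (- (2 * pi * y / h))"
  define f where "f = Abs_fps a"
  have "r > 0" by (simp add: r_def)
  have y: "Complex 0 y \<in> upper_half_plane"
    using assms(3) by (simp add: mem_upper_half_plane)
  obtain K where K: "summable (\<lambda>k. a k * K ^ k)" "r < norm K"
    using fourier_expansion_inside[OF assms(1,2) y] by (auto simp: norm_nome r_def)
  have radius: "ereal r < fps_conv_radius f"
  proof -
    have "ereal r < ereal (norm K)" using K(2) by simp
    also have "\<dots> \<le> fps_conv_radius f"
      unfolding fps_conv_radius_def f_def using K(1) by (intro conv_radius_geI) simp
    finally show ?thesis .
  qed
  have holo: "eval_fps f holomorphic_on cball 0 r"
  proof (rule holomorphic_on_eval_fps)
    show "cball (0 :: complex) r \<subseteq> eball 0 (fps_conv_radius f)"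
    proof
      fix x :: complex assume "x \<in> cball 0 r"
      then have "ereal (norm x) \<le> ereal r" by simp
      then have "ereal (norm x) < fps_conv_radius f" using radius by (rule le_less_trans)
      then show "x \<in> eball 0 (fps_conv_radius f)" by simp
    qed
  qed
  have "norm ((deriv ^^ k) (eval_fps f) 0) \<le> fact k * B / r ^ k"
  proof (rule Cauchy_inequality[OF _ _ \<open>r > 0\<close>])
    show "eval_fps f holomorphic_on ball 0 r"
      using holo by (rule holomorphic_on_subset) auto
    show "continuous_on (cball 0 r) (eval_fps f)"
      using holo by (rule holomorphic_on_imp_continuous_on)
    fix q :: complex assume "norm (0 - q) = r"
    then obtain z where z: "nome h z = q" "Im z = y" "\<bar>Re z\<bar> \<le> \<bar>h\<bar>"
      using exists_nome_eq[OF assms(1), of q y] by (auto simp: r_def)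
    have "(\<lambda>k. a k * q ^ k) sums F z"
      using assms(2,3) z unfolding has_fourier_expansion_iff by (auto simp: mem_upper_half_plane)
    then have "eval_fps f q = F z"
      by (simp add: eval_fps_def f_def sums_iff)
    then show "norm (eval_fps f q) \<le> B"
      using B z by simp
  qed
  then have "norm ((deriv ^^ k) (eval_fps f) 0) / fact k \<le> fact k * B / r ^ k / fact k"
    by (rule divide_right_mono) simp
  moreover have "a k = (deriv ^^ k) (eval_fps f) 0 / fact k"
    using fps_nth_conv_deriv[of f k] radius \<open>r > 0\<close>
    by (simp add: f_def) (metis ereal_less(2) less_trans)
  ultimately have "norm (a k) \<le> B / r ^ k"
    by (simp add: norm_divide)
  also have "B / r ^ k = B * exp (2 * pi * real k * y / h)"
    by (simp add: r_def exp_minus power_inverse[symmetric] divide_inverse exp_of_nat_mult[symmetric] mult_ac)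
  finally show ?thesis .
qed

text \<open>The difference of two expansions of \<open>F\<close> represents \<open>0\<close>, and \<open>fourier_coeff_bound\<close> applies with
  \<open>B = 0\<close>.\<close>

lemma fourier_coeff_eqI:
  assumes "h \<noteq> 0" "has_fourier_expansion h F a"
  shows "fourier_coeff h F = a"
proof
  fix k
  have "has_fourier_expansion h F (fourier_coeff h F)"
    unfolding fourier_coeff_def by (rule someI[of "has_fourier_expansion h F", OF assms(2)])
  from fourier_expansion_diff[OF this assms(2)]
  have "has_fourier_expansion h (\<lambda>z. F z - F z) (\<lambda>k. fourier_coeff h F k - a k)" .
  from fourier_coeff_bound[OF assms(1) this, of 1 0 k]
  show "fourier_coeff h F k = a k" by simp
qed

section \<open>Polynomial growth of the coefficients\<close>

definition polynomial_growth :: "(nat \<Rightarrow> complex) \<Rightarrow> bool" where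
  "polynomial_growth a \<longleftrightarrow> (\<exists>C K. \<forall>k. norm (a k) \<le> C * real (Suc k) ^ K)"

lemma polynomial_growthE:
  assumes "polynomial_growth a"
  obtains C K where "C \<ge> 0" "\<And>k. norm (a k) \<le> C * real (Suc k) ^ K"
proof -
  obtain C K where CK: "\<And>k. norm (a k) \<le> C * real (Suc k) ^ K"
    using assms by (auto simp: polynomial_growth_def)
  have "0 \<le> norm (a 0)" by simp
  also have "\<dots> \<le> C" using CK[of 0] by simp
  finally show ?thesis using that CK by blast
qed

text \<open>Hecke's estimate: on one period of \<open>Im z = 1/(k + 1)\<close> the function is at most of order \<open>(k + 1)\<^sup>\<kappa>\<close>, while
  the exponential factor in \<open>fourier_coeff_bound\<close> stays bounded. For \<open>h < 0\<close> the function is in fact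
  constant on the half plane, but the same estimate applies.\<close>

lemma polynomial_growth_moderate:
  assumes "h \<noteq> 0" "F \<in> moderate_holomorphic" "has_fourier_expansion h F a"
  shows "polynomial_growth a"
proof -
  obtain \<kappa> C where \<kappa>: "\<kappa> > 0"
    and C: "\<And>z. z \<in> upper_half_plane \<Longrightarrow> norm (F z) \<le> C * (Im z / (1 + (norm z)\<^sup>2)) powr (-\<kappa>)"
    using assms(2) unfolding moderate_holomorphic_def by blast
  define D where "D = 2 + h\<^sup>2"
  define K where "K = nat \<lceil>\<kappa>\<rceil>"
  have D: "D \<ge> 1" by (simp add: D_def)
  have "norm (a k) \<le> (\<bar>C\<bar> * D ^ K * exp (2 * pi / \<bar>h\<bar>)) * real (Suc k) ^ K" for k
  proof -
    define y where "y = 1 / real (Suc k)"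
    have y: "0 < y" "y \<le> 1" by (auto simp: y_def)
    \<comment> \<open>On one period \<open>1 + |z|\<^sup>2\<close> is at most \<open>D\<close>; the absolute value of \<open>C\<close> makes the bound monotone.\<close>
    have "norm (F z) \<le> \<bar>C\<bar> * (D * real (Suc k)) ^ K" if z: "Im z = y" "\<bar>Re z\<bar> \<le> \<bar>h\<bar>" for z
    proof -
      have "(norm z)\<^sup>2 \<le> h\<^sup>2 + 1"
        using z y power2_le_iff_abs_le[of "\<bar>h\<bar>" "Re z"] power_le_one[of y 2]
        by (simp add: cmod_power2 abs_le_square_iff)
      then have "y / D \<le> y / (1 + (norm z)\<^sup>2)"
        using y D by (intro divide_left_mono mult_pos_pos add_pos_nonneg) (auto simp: D_def add_pos_nonneg)
      then have "(Im z / (1 + (norm z)\<^sup>2)) powr (-\<kappa>) \<le> (y / D) powr (-\<kappa>)"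
        unfolding z(1) using y D \<kappa> by (intro powr_mono2') auto
      also have "\<dots> = (D * real (Suc k)) powr \<kappa>"
        using D by (simp add: y_def powr_minus powr_divide powr_mult field_simps)
      also have "\<dots> \<le> (D * real (Suc k)) powr real K"
        using D mult_mono[of 1 D 1 "real (Suc k)"] by (intro powr_mono) (auto simp: K_def real_nat_ceiling_ge)
      also have "\<dots> = (D * real (Suc k)) ^ K"
        using D by (subst powr_realpow) auto
      finally have "\<bar>C\<bar> * (Im z / (1 + (norm z)\<^sup>2)) powr (-\<kappa>) \<le> \<bar>C\<bar> * (D * real (Suc k)) ^ K"
        by (rule mult_left_mono) simp
      moreover have "norm (F z) \<le> \<bar>C\<bar> * (Im z / (1 + (norm z)\<^sup>2)) powr (-\<kappa>)"
        using z y by (intro order_trans[OF C] mult_right_mono) (auto simp: mem_upper_half_plane)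
      ultimately show ?thesis by linarith
    qed
    from fourier_coeff_bound[OF assms(1,3) y(1) this, of k]
    have "norm (a k) \<le> \<bar>C\<bar> * (D * real (Suc k)) ^ K * exp (2 * pi * real k * y / h)"
      by simp
    also have "\<dots> \<le> \<bar>C\<bar> * (D * real (Suc k)) ^ K * exp (2 * pi / \<bar>h\<bar>)"
    proof (intro mult_left_mono)
      have "2 * pi * (real k * y) / h \<le> \<bar>2 * pi * (real k * y) / h\<bar>" by (rule abs_ge_self)
      also have "\<dots> = 2 * pi * (real k * y) / \<bar>h\<bar>"
        using y by (simp add: abs_mult)
      also have "\<dots> \<le> 2 * pi * 1 / \<bar>h\<bar>"
        by (intro divide_right_mono mult_left_mono) (auto simp: y_def)
      finally show "exp (2 * pi * real k * y / h) \<le> exp (2 * pi / \<bar>h\<bar>)"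
        by (simp add: mult_ac)
    qed (use D in auto)
    finally show ?thesis by (simp add: power_mult_distrib mult_ac)
  qed
  then show ?thesis
    unfolding polynomial_growth_def by blast
qed

lemma polynomial_growth_cmult:
  assumes "polynomial_growth a"
  shows "polynomial_growth (\<lambda>k. c * a k)"
proof -
  obtain C K where C: "\<And>k. norm (a k) \<le> C * real (Suc k) ^ K"
    using polynomial_growthE[OF assms] by blast
  have "norm (c * a k) \<le> norm c * C * real (Suc k) ^ K" for k
    using mult_left_mono[OF C[of k] norm_ge_zero[of c]] by (simp add: norm_mult mult_ac)
  then show ?thesis unfolding polynomial_growth_def by blast
qed

lemma polynomial_growth_add:
  assumes "polynomial_growth a" "polynomial_growth b"
  shows "polynomial_growth (\<lambda>k. a k + b k)"
proof -
  obtain C K where C: "C \<ge> 0" "\<And>k. norm (a k) \<le> C * real (Suc k) ^ K"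
    using polynomial_growthE[OF assms(1)] by blast
  obtain D L where D: "D \<ge> 0" "\<And>k. norm (b k) \<le> D * real (Suc k) ^ L"
    using polynomial_growthE[OF assms(2)] by blast
  have "norm (a k + b k) \<le> (C + D) * real (Suc k) ^ (K + L)" for k
  proof -
    have "norm (a k + b k) \<le> C * real (Suc k) ^ K + D * real (Suc k) ^ L"
      using norm_triangle_ineq[of "a k" "b k"] C(2)[of k] D(2)[of k] by linarith
    also have "\<dots> \<le> C * real (Suc k) ^ (K + L) + D * real (Suc k) ^ (K + L)"
      using C D by (intro add_mono mult_left_mono power_increasing) auto
    finally show ?thesis by (simp add: algebra_simps)
  qed
  then show ?thesis unfolding polynomial_growth_def by blast
qed

lemma polynomial_growth_sum:
  assumes "\<And>i. i \<in> I \<Longrightarrow> polynomial_growth (a i)"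
  shows "polynomial_growth (\<lambda>k. \<Sum>i\<in>I. a i k)"
proof -
  have "polynomial_growth (\<lambda>k. 0)"
    unfolding polynomial_growth_def by (intro exI[of _ 0]) simp
  with assms show ?thesis
    by (induction I rule: infinite_finite_induct) (auto intro: polynomial_growth_add)
qed

lemma polynomial_growth_power_mult:
  assumes "polynomial_growth a"
  shows "polynomial_growth (\<lambda>k. (c * of_nat k) ^ m * a k)"
proof -
  obtain C K where C: "C \<ge> 0" "\<And>k. norm (a k) \<le> C * real (Suc k) ^ K"
    using polynomial_growthE[OF assms(1)] by blast
  have "norm ((c * of_nat k) ^ m * a k) \<le> (norm c ^ m * C) * real (Suc k) ^ (m + K)" for k
  proof -
    have "norm ((c * of_nat k) ^ m * a k) = norm c ^ m * (real k ^ m * norm (a k))"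
      by (simp add: norm_mult norm_power power_mult_distrib)
    also have "\<dots> \<le> norm c ^ m * (real (Suc k) ^ m * (C * real (Suc k) ^ K))"
      using C by (intro mult_left_mono mult_mono power_mono) auto
    finally show ?thesis by (simp add: power_add mult_ac)
  qed
  then show ?thesis unfolding polynomial_growth_def by blast
qed

lemma polynomial_growth_convolution:
  assumes "polynomial_growth a" "polynomial_growth b"
  shows "polynomial_growth (\<lambda>k. \<Sum>i\<le>k. a i * b (k - i))"
proof -
  obtain C K where C: "C \<ge> 0" "\<And>k. norm (a k) \<le> C * real (Suc k) ^ K"
    using polynomial_growthE[OF assms(1)] by blast
  obtain D L where D: "D \<ge> 0" "\<And>k. norm (b k) \<le> D * real (Suc k) ^ L"
    using polynomial_growthE[OF assms(2)] by blast
  have "norm (\<Sum>i\<le>k. a i * b (k - i)) \<le> (C * D) * real (Suc k) ^ Suc (K + L)" for k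
  proof -
    have "norm (\<Sum>i\<le>k. a i * b (k - i)) \<le> (\<Sum>i\<le>k. (C * real (Suc k) ^ K) * (D * real (Suc k) ^ L))"
    proof (rule sum_norm_le)
      fix i assume i: "i \<in> {..k}"
      have "norm (a i) \<le> C * real (Suc k) ^ K"
        using i C by (intro order_trans[OF C(2)] mult_left_mono power_mono) auto
      moreover have "norm (b (k - i)) \<le> D * real (Suc k) ^ L"
        using i D by (intro order_trans[OF D(2)] mult_left_mono power_mono) auto
      ultimately show "norm (a i * b (k - i)) \<le> (C * real (Suc k) ^ K) * (D * real (Suc k) ^ L)"
        unfolding norm_mult using C by (intro mult_mono) auto
    qed
    then show ?thesis by (simp add: power_add mult_ac)
  qed
  then show ?thesis unfolding polynomial_growth_def by blast
qed

lemma polynomial_growth_dirichlet_summable: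
  assumes "polynomial_growth a"
  shows "\<exists>\<sigma>. \<forall>s. \<sigma> < Re s \<longrightarrow> summable (\<lambda>k. a (Suc k) * of_nat (Suc k) powr (-s))"
proof -
  obtain C K where C: "C \<ge> 0" "\<And>k. norm (a k) \<le> C * real (Suc k) ^ K"
    using polynomial_growthE[OF assms] by blast
  have "summable (\<lambda>k. a (Suc k) * of_nat (Suc k) powr (-s))" if s: "real K + 1 < Re s" for s
  proof (rule summable_comparison_test')
    have "summable (\<lambda>k. real k powr (real K - Re s))"
      using s by (simp add: summable_real_powr_iff)
    then have "summable (\<lambda>k. real (Suc k) powr (real K - Re s))"
      by (subst summable_Suc_iff)
    then show "summable (\<lambda>k. C * 2 ^ K * real (Suc k) powr (real K - Re s))"
      by (rule summable_mult)
    fix k :: nat assume "k \<ge> 0"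
    have "norm (a (Suc k)) \<le> C * (2 * real (Suc k)) ^ K"
      using C by (intro order_trans[OF C(2)] mult_left_mono power_mono) auto
    moreover have "norm ((of_nat (Suc k) :: complex) powr (-s)) = real (Suc k) powr (- Re s)"
      by (subst norm_powr_real_powr) auto
    ultimately have "norm (a (Suc k) * of_nat (Suc k) powr (-s))
        \<le> C * (2 * real (Suc k)) ^ K * real (Suc k) powr (- Re s)"
      unfolding norm_mult by (intro mult_mono) (use C in auto)
    also have "\<dots> = C * 2 ^ K * (real (Suc k) powr real K * real (Suc k) powr (- Re s))"
      by (simp only: powr_realpow[OF of_nat_0_less_iff[THEN iffD2, OF zero_less_Suc]]
          power_mult_distrib mult_ac)
    also have "\<dots> = C * 2 ^ K * real (Suc k) powr (real K - Re s)"
      by (simp only: powr_add[symmetric]) simp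
    finally show "norm (a (Suc k) * of_nat (Suc k) powr (-s))
        \<le> C * 2 ^ K * real (Suc k) powr (real K - Re s)" .
  qed
  then show ?thesis by blast
qed

section \<open>The Dirichlet series\<close>

theorem theorem1p1:
  fixes \<Gamma> :: "(real^2^2) set" and \<mu> \<nu> m n :: nat and h :: real
    and \<phi> \<psi> :: "complex \<Rightarrow> complex"
  assumes "subgroup \<Gamma> SL2R" and "discrete \<Gamma>" and "contains_translations \<Gamma>"
    and "h \<noteq> 0"
    and "\<phi> \<in> modular_forms \<Gamma> (int \<mu>)" and "\<exists>a. has_fourier_expansion h \<phi> a"
    and "\<psi> \<in> modular_forms \<Gamma> (int \<nu>)" and "\<exists>b. has_fourier_expansion h \<psi> b"
    and "1 \<le> \<mu> + m" and "1 \<le> \<nu> + n" and "2 \<le> \<mu> + \<nu>"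
  shows "\<exists>\<sigma>::real. \<forall>s::complex. \<sigma> < Re s \<longrightarrow>
    dirichlet_L_converges h (\<lambda>z. (deriv ^^ m) \<phi> z * (deriv ^^ n) \<psi> z) s \<and>
    (\<forall>l\<in>{0..m + n}. dirichlet_L_converges h (rankin_cohen \<mu> \<nu> (m + n - l) \<phi> \<psi>) (s - of_nat l)) \<and>
    dirichlet_L h (\<lambda>z. (deriv ^^ m) \<phi> z * (deriv ^^ n) \<psi> z) s =
      (\<Sum>l=0..m + n. rc_coeff \<mu> \<nu> m n h l
         * dirichlet_L h (rankin_cohen \<mu> \<nu> (m + n - l) \<phi> \<psi>) (s - of_nat l))"
proof -
  define c :: complex where "c = 2 * of_real pi * \<i> / of_real h"
  define F where "F = (\<lambda>z. (deriv ^^ m) \<phi> z * (deriv ^^ n) \<psi> z)"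
  define R where "R l = rankin_cohen \<mu> \<nu> (m + n - l) \<phi> \<psi>" for l
  obtain a b where a: "has_fourier_expansion h \<phi> a" and b: "has_fourier_expansion h \<psi> b"
    using assms by blast
  have growth: "polynomial_growth a" "polynomial_growth b"
    using assms(5,7) polynomial_growth_moderate[OF assms(4) _ a] polynomial_growth_moderate[OF assms(4) _ b]
    by (simp_all add: modular_forms_def)
  define p where "p r s k = (\<Sum>i\<le>k. (c * of_nat i) ^ r * a i * ((c * of_nat (k - i)) ^ s * b (k - i)))"
    for r s k
  have p_fourier: "has_fourier_expansion h (\<lambda>z. (deriv ^^ r) \<phi> z * (deriv ^^ s) \<psi> z) (p r s)" for r s
    unfolding p_def c_def
    by (intro fourier_expansion_mult fourier_expansion_higher_deriv a b assms(4))
  have p_growth: "polynomial_growth (p r s)" for r s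
    unfolding p_def by (intro polynomial_growth_convolution polynomial_growth_power_mult growth)
  define t where "t l k = (\<Sum>r=0..m + n - l. (-1) ^ r * of_nat ((\<mu> + (m + n - l) - 1) choose (m + n - l - r))
      * of_nat ((\<nu> + (m + n - l) - 1) choose r) * p r (m + n - l - r) k)" for l k
  have t_fourier: "has_fourier_expansion h (R l) (t l)" for l
  proof -
    have "R l = (\<lambda>z. \<Sum>r=0..m + n - l. (-1) ^ r * of_nat ((\<mu> + (m + n - l) - 1) choose (m + n - l - r))
      * of_nat ((\<nu> + (m + n - l) - 1) choose r) * ((deriv ^^ r) \<phi> z * (deriv ^^ (m + n - l - r)) \<psi> z))"
      unfolding R_def by (rule ext) (simp only: rankin_cohen_def mult.assoc)
    then show ?thesis
      unfolding t_def
      by (simp only:) (intro fourier_expansion_sum fourier_expansion_cmult p_fourier)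
  qed
  have t_growth: "polynomial_growth (t l)" for l
    unfolding t_def by (intro polynomial_growth_sum polynomial_growth_cmult p_growth)
  \<comment> \<open>The form is evaluated at \<open>2\<pi>i/h\<close> times the indices of the two Fourier coefficients.\<close>
  have t_form: "t l k = (\<Sum>i\<le>k. a i * b (k - i)
      * bracket_form \<mu> \<nu> (m + n - l) (c * of_nat i) (c * of_nat (k - i)))" for l k
    unfolding t_def p_def bracket_form_def atLeast0AtMost sum_distrib_left
    by (subst sum.swap) (simp only: mult_ac)
  have p_eq: "p m n k = (\<Sum>l=0..m + n. rc_coeff \<mu> \<nu> m n h l * (of_nat k ^ l * t l k))" for k
  proof -
    have "p m n k = (\<Sum>i\<le>k. a i * b (k - i) * ((c * of_nat i) ^ m * (c * of_nat (k - i)) ^ n))"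
      unfolding p_def by (simp only: mult_ac)
    also have "\<dots> = (\<Sum>i\<le>k. \<Sum>l\<le>m + n. rc_coeff \<mu> \<nu> m n h l * (of_nat k ^ l * (a i * b (k - i)
        * bracket_form \<mu> \<nu> (m + n - l) (c * of_nat i) (c * of_nat (k - i)))))"
    proof (intro sum.cong refl)
      fix i assume "i \<in> {..k}"
      then have k: "c * of_nat i + c * of_nat (k - i) = c * of_nat k"
        by (simp add: of_nat_diff algebra_simps)
      show "a i * b (k - i) * ((c * of_nat i) ^ m * (c * of_nat (k - i)) ^ n)
        = (\<Sum>l\<le>m + n. rc_coeff \<mu> \<nu> m n h l * (of_nat k ^ l * (a i * b (k - i)
            * bracket_form \<mu> \<nu> (m + n - l) (c * of_nat i) (c * of_nat (k - i)))))"
        unfolding monomial_eq_sum_bracket_form[OF assms(9-11)] k sum_distrib_left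
        by (intro sum.cong refl) (simp add: rc_coeff_eq c_def[symmetric] power_mult_distrib)
    qed
    also have "\<dots> = (\<Sum>l=0..m + n. rc_coeff \<mu> \<nu> m n h l * (of_nat k ^ l * t l k))"
      unfolding t_form atLeast0AtMost sum_distrib_left by (rule sum.swap)
    finally show ?thesis .
  qed
  have "\<forall>l. \<exists>\<sigma>. \<forall>s. \<sigma> < Re s \<longrightarrow> summable (\<lambda>k. t l (Suc k) * of_nat (Suc k) powr (-s))"
    using t_growth by (intro allI polynomial_growth_dirichlet_summable)
  from choice[OF this] obtain \<sigma>
    where \<sigma>: "\<And>l s. \<sigma> l < Re s \<Longrightarrow> summable (\<lambda>k. t l (Suc k) * of_nat (Suc k) powr (-s))"
    by blast
  \<comment> \<open>The bracket of index \<open>l\<close> is evaluated at \<open>s - l\<close>, hence its abscissa is shifted by \<open>l\<close>.\<close>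
  define \<sigma>' where "\<sigma>' = (\<Sum>l\<le>m + n. \<bar>\<sigma> l\<bar> + real l)"
  have coeff_F: "fourier_coeff h F = p m n"
    unfolding F_def by (rule fourier_coeff_eqI[OF assms(4) p_fourier])
  have coeff_R: "fourier_coeff h (R l) = t l" for l
    by (rule fourier_coeff_eqI[OF assms(4) t_fourier])
  have main: "dirichlet_L_converges h F s \<and> (\<forall>l\<in>{0..m + n}. dirichlet_L_converges h (R l) (s - of_nat l))
      \<and> dirichlet_L h F s = (\<Sum>l=0..m + n. rc_coeff \<mu> \<nu> m n h l * dirichlet_L h (R l) (s - of_nat l))"
    if s: "\<sigma>' < Re s" for s
  proof -
    have summ: "summable (\<lambda>k. t l (Suc k) * of_nat (Suc k) powr (- (s - of_nat l)))"
      if "l \<in> {0..m + n}" for l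
    proof (rule \<sigma>)
      have "\<bar>\<sigma> l\<bar> + real l \<le> \<sigma>'"
        unfolding \<sigma>'_def using that by (intro member_le_sum) auto
      then show "\<sigma> l < Re (s - of_nat l)" using s by simp
    qed
    have term_eq: "p m n (Suc k) * of_nat (Suc k) powr (-s) = (\<Sum>l=0..m + n. rc_coeff \<mu> \<nu> m n h l
        * (t l (Suc k) * of_nat (Suc k) powr (- (s - of_nat l))))" for k
    proof -
      have pow: "of_nat (Suc k) ^ l * of_nat (Suc k) powr (-s)
          = (of_nat (Suc k) powr (- (s - of_nat l)) :: complex)" for l
      proof -
        have "of_nat (Suc k) powr (- (s - of_nat l))
            = (of_nat (Suc k) powr of_nat l * of_nat (Suc k) powr (-s) :: complex)"
          unfolding powr_add[symmetric] by simp
        also have "of_nat (Suc k) powr of_nat l = (of_nat (Suc k) ^ l :: complex)"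
          by (rule powr_nat') (simp del: of_nat_Suc)
        finally show ?thesis ..
      qed
      then show ?thesis
        unfolding p_eq sum_distrib_right by (intro sum.cong refl) (simp only: pow[symmetric] mult_ac)
    qed
    have sums: "(\<lambda>k. p m n (Suc k) * of_nat (Suc k) powr (-s)) sums
        (\<Sum>l=0..m + n. rc_coeff \<mu> \<nu> m n h l * dirichlet_L h (R l) (s - of_nat l))"
      unfolding term_eq dirichlet_L_def coeff_R
      by (intro sums_sum sums_mult summable_sums summ)
    show ?thesis
    proof (intro conjI ballI)
      show "dirichlet_L_converges h F s"
        unfolding dirichlet_L_converges_def coeff_F
        unfolding F_def using sums_summable[OF sums] p_fourier by blast
      show "dirichlet_L_converges h (R l) (s - of_nat l)" if "l \<in> {0..m + n}" for l
        unfolding dirichlet_L_converges_def coeff_R using summ[OF that] t_fourier by blast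
      show "dirichlet_L h F s = (\<Sum>l=0..m + n. rc_coeff \<mu> \<nu> m n h l * dirichlet_L h (R l) (s - of_nat l))"
        using sums unfolding dirichlet_L_def[of h F] coeff_F by (rule sums_unique[symmetric])
    qed
  qed
  show ?thesis
    by (intro exI[of _ \<sigma>'] allI impI) (rule main[unfolded F_def R_def])
qed

end
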